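(* Let $G$ be a local analytic Moufang loop with unit $e$, with infinitesimal translations $L_x, R_x, M_x$ ($x\in T_e(G)$), Yamagutian $Y(x;y)$ and ternary Yamaguti bracket $[x,y,z]$ on $T_e(G)$, as defined in the context. Then the infinitesimal translations satisfy the reductivity conditions: for all $x,y,z\in T_e(G)$, as analytic vector fields near $e$, $$6[Y(x;y),L_z]=L_{[x,y,z]},$$ $$6[Y(x;y),R_z]=R_{[x,y,z]},$$ $$6[Y(x;y),M_z]=M_{[x,y,z]}.$$
   Context: A Moufang loop is a loop (quasigroup with unit $e$) satisfying the Moufang identity $(ag)(ha)=a((gh)a)$. A local analytic Moufang loop $G$ is a finite-dimensional real analytic local loop: a neighbourhood of $e$ in a real analytic manifold, with analytic product and inversion defined and satisfying these identities for elements sufficiently close to $e$. Fix local coordinates $g^i$ with $e$ at the origin ($e^i=0$); write $(gh)^i$ for the coordinates of the product. Summation over repeated indices is understood, and all identities are for elements sufficiently close to $e$. Auxiliary functions: $u^i_j(g)=\left.\frac{\partial (hg)^i}{\partial h^j}\right|_{h=e}$, $v^i_j(g)=\left.\frac{\partial (gh)^i}{\partial h^j}\right|_{h=e}$, and $w^i_j(g)=-u^i_j(g)-v^i_j(g)$. Infinitesimal translations: for $x=(x^j)\in T_e(G)$, the vector fields $L_x=x^ju^s_j(g)\frac{\partial}{\partial g^s}$, $R_x=x^jv^s_j(g)\frac{\partial}{\partial g^s}$, $M_x=x^jw^s_j(g)\frac{\partial}{\partial g^s}$, so that $L_x+R_x+M_x=0$. The bracket $[\cdot,\cdot]$ of vector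 fields is the usual commutator. Yamagutian: the vector field $Y(x;y)$ is defined by $6Y(x;y)=[L_x,L_y]+[R_x,R_y]+[M_x,M_y]$. Secondary auxiliary functions: $u^s_{jk}=u^p_k\frac{\partial u^s_j}{\partial g^p}-u^p_j\frac{\partial u^s_k}{\partial g^p}$, $v^s_{jk}=v^p_k\frac{\partial v^s_j}{\partial g^p}-v^p_j\frac{\partial v^s_k}{\partial g^p}$, $w^s_{jk}=w^p_k\frac{\partial w^s_j}{\partial g^p}-w^p_j\frac{\partial w^s_k}{\partial g^p}$. Yamaguti functions: $6Y^s_{jk}(g)=u^s_{jk}(g)+v^s_{jk}(g)+w^s_{jk}(g)$. Yamaguti constants $Y^i_{jkl}$: defined by the expansion $Y^i_{jk}(g)=Y^i_{jkl}g^l+O(g^2)$ at $e$. Ternary Yamaguti bracket on $T_e(G)$: $[x,y,z]^i=6Y^i_{jkl}x^jy^kz^l$. *)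

theory Defs
  imports "HOL-Analysis.Analysis" "HOL-Library.Landau_Symbols"
begin

section \<open>Real analytic maps\<close>

text \<open>Multi-indices are the functions \<open>\<alpha>\<close> from the basis to \<open>nat\<close>, taken extensional so
  that each one is counted once; \<open>c \<alpha>\<close> is the coefficient of the monomial with exponent \<open>\<alpha>\<close>.\<close>

definition real_analytic_at ::
  "('a::euclidean_space \<Rightarrow> 'b::real_normed_vector) \<Rightarrow> 'a \<Rightarrow> bool" where
  "real_analytic_at f a \<longleftrightarrow>
    (\<exists>(c :: ('a \<Rightarrow> nat) \<Rightarrow> 'b) r. r > 0 \<and>
      (\<forall>x\<in>ball a r.
        ((\<lambda>\<alpha>. (\<Prod>b\<in>Basis. ((x - a) \<bullet> b) ^ \<alpha> b) *\<^sub>R c \<alpha>) has_sum f x)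
          (Basis \<rightarrow>\<^sub>E UNIV)))"


section \<open>Local analytic Moufang loops\<close>

text \<open>The loop is given in a chart with the unit at the origin. The product and the inversion are
  total functions in HOL, but only their germs at the origin matter: every
  hypothesis concerns elements sufficiently close to the origin, and values elsewhere are
  arbitrary. The axiom \<open>local_quasigroup\<close> is the local form of unique left and right
  divisibility.\<close>

locale local_analytic_Moufang_loop =
  fixes mul :: "real ^ 'n \<Rightarrow> real ^ 'n \<Rightarrow> real ^ 'n"
    and iv :: "real ^ 'n \<Rightarrow> real ^ 'n"
  assumes mul_analytic:
      "\<forall>\<^sub>F p in nhds (0, 0). real_analytic_at (\<lambda>(g, h). mul g h) p"
    and iv_analytic: "\<forall>\<^sub>F g in nhds 0. real_analytic_at iv g"
    and unit: "\<forall>\<^sub>F g in nhds 0. mul 0 g = g \<and> mul g 0 = g"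
    and local_quasigroup:
      "\<exists>U V. open U \<and> 0 \<in> U \<and> open V \<and> 0 \<in> V \<and>
        (\<forall>a\<in>U. \<forall>b\<in>U. (\<exists>!x\<in>V. mul a x = b) \<and> (\<exists>!y\<in>V. mul y a = b))"
    and iv_zero: "iv 0 = 0"
    and inverse: "\<forall>\<^sub>F g in nhds 0. mul g (iv g) = 0 \<and> mul (iv g) g = 0"
    and Moufang:
      "\<forall>\<^sub>F (a, g, h) in nhds (0, 0, 0).
        mul (mul a g) (mul h a) = mul a (mul (mul g h) a)"


section \<open>Vector fields in coordinates\<close>

definition partial :: "'n \<Rightarrow> (real ^ 'n \<Rightarrow> real) \<Rightarrow> real ^ 'n \<Rightarrow> real" where
  "partial p f g = deriv (\<lambda>t. f (g + t *\<^sub>R axis p 1)) 0"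

definition lie_bracket ::
  "(real ^ 'n \<Rightarrow> real ^ 'n) \<Rightarrow> (real ^ 'n \<Rightarrow> real ^ 'n) \<Rightarrow> real ^ 'n \<Rightarrow> real ^ 'n" where
  "lie_bracket X Y g =
    (\<chi> s. \<Sum>p\<in>UNIV. X g $ p * partial p (\<lambda>g'. Y g' $ s) g
                  - Y g $ p * partial p (\<lambda>g'. X g' $ s) g)"


section \<open>Auxiliary functions and infinitesimal translations\<close>

text \<open>For all functions below, the upper index is the first index argument:
  \<open>aux_u mul i j g\<close> stands for \<open>u\<^sup>i\<^sub>j(g)\<close>.\<close>

definition aux_u :: "(real ^ 'n \<Rightarrow> real ^ 'n \<Rightarrow> real ^ 'n) \<Rightarrow> 'n \<Rightarrow> 'n \<Rightarrow> real ^ 'n \<Rightarrow> real" where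
  "aux_u mul i j g = partial j (\<lambda>h. mul h g $ i) 0"

definition aux_v :: "(real ^ 'n \<Rightarrow> real ^ 'n \<Rightarrow> real ^ 'n) \<Rightarrow> 'n \<Rightarrow> 'n \<Rightarrow> real ^ 'n \<Rightarrow> real" where
  "aux_v mul i j g = partial j (\<lambda>h. mul g h $ i) 0"

definition aux_w :: "(real ^ 'n \<Rightarrow> real ^ 'n \<Rightarrow> real ^ 'n) \<Rightarrow> 'n \<Rightarrow> 'n \<Rightarrow> real ^ 'n \<Rightarrow> real" where
  "aux_w mul i j g = - aux_u mul i j g - aux_v mul i j g"

definition translation_field ::
  "('n \<Rightarrow> 'n \<Rightarrow> real ^ 'n \<Rightarrow> real) \<Rightarrow> real ^ 'n \<Rightarrow> real ^ 'n \<Rightarrow> real ^ 'n" where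
  "translation_field a x g = (\<chi> s. \<Sum>j\<in>UNIV. x $ j * a s j g)"

definition transl_L ::
  "(real ^ 'n \<Rightarrow> real ^ 'n \<Rightarrow> real ^ 'n) \<Rightarrow> real ^ 'n \<Rightarrow> real ^ 'n \<Rightarrow> real ^ 'n" where
  "transl_L mul x = translation_field (aux_u mul) x"

definition transl_R ::
  "(real ^ 'n \<Rightarrow> real ^ 'n \<Rightarrow> real ^ 'n) \<Rightarrow> real ^ 'n \<Rightarrow> real ^ 'n \<Rightarrow> real ^ 'n" where
  "transl_R mul x = translation_field (aux_v mul) x"

definition transl_M ::
  "(real ^ 'n \<Rightarrow> real ^ 'n \<Rightarrow> real ^ 'n) \<Rightarrow> real ^ 'n \<Rightarrow> real ^ 'n \<Rightarrow> real ^ 'n" where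
  "transl_M mul x = translation_field (aux_w mul) x"

definition Yamagutian ::
  "(real ^ 'n \<Rightarrow> real ^ 'n \<Rightarrow> real ^ 'n) \<Rightarrow> real ^ 'n \<Rightarrow> real ^ 'n \<Rightarrow> real ^ 'n \<Rightarrow> real ^ 'n" where
  "Yamagutian mul x y g =
    (1 / 6) *\<^sub>R (lie_bracket (transl_L mul x) (transl_L mul y) g
             + lie_bracket (transl_R mul x) (transl_R mul y) g
             + lie_bracket (transl_M mul x) (transl_M mul y) g)"


section \<open>Yamaguti functions, constants and bracket\<close>

definition secondary ::
  "('n \<Rightarrow> 'n \<Rightarrow> real ^ 'n \<Rightarrow> real) \<Rightarrow> 'n \<Rightarrow> 'n \<Rightarrow> 'n \<Rightarrow> real ^ 'n \<Rightarrow> real" where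
  "secondary a s j k g =
    (\<Sum>p\<in>UNIV. a p k g * partial p (a s j) g - a p j g * partial p (a s k) g)"

definition Yamaguti_fun ::
  "(real ^ 'n \<Rightarrow> real ^ 'n \<Rightarrow> real ^ 'n) \<Rightarrow> 'n \<Rightarrow> 'n \<Rightarrow> 'n \<Rightarrow> real ^ 'n \<Rightarrow> real" where
  "Yamaguti_fun mul s j k g =
    (1 / 6) * (secondary (aux_u mul) s j k g
             + secondary (aux_v mul) s j k g
             + secondary (aux_w mul) s j k g)"

text \<open>The coefficient vector of the expansion at the origin
  \<open>Y\<^sup>i\<^sub>j\<^sub>k(g) = Y\<^sup>i\<^sub>j\<^sub>k\<^sub>l g\<^sup>l + O(g\<^sup>2)\<close>, with \<open>l\<close> as the component. Such an expansion, which has no constant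
  term, determines the coefficients uniquely.\<close>

definition Yamaguti_const ::
  "(real ^ 'n \<Rightarrow> real ^ 'n \<Rightarrow> real ^ 'n) \<Rightarrow> 'n \<Rightarrow> 'n \<Rightarrow> 'n \<Rightarrow> real ^ 'n" where
  "Yamaguti_const mul i j k =
    (THE c. (\<lambda>g. Yamaguti_fun mul i j k g - (\<Sum>l\<in>UNIV. c $ l * g $ l))
              \<in> O[nhds 0](\<lambda>g. (norm g)\<^sup>2))"

definition Yamaguti_bracket ::
  "(real ^ 'n \<Rightarrow> real ^ 'n \<Rightarrow> real ^ 'n) \<Rightarrow> real ^ 'n \<Rightarrow> real ^ 'n \<Rightarrow> real ^ 'n \<Rightarrow> real ^ 'n" where
  "Yamaguti_bracket mul x y z =
    (\<chi> i. 6 * (\<Sum>j\<in>UNIV. \<Sum>k\<in>UNIV. \<Sum>l\<in>UNIV.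
                Yamaguti_const mul i j k $ l * x $ j * y $ k * z $ l))"

end

theory Submission
  imports Defs
begin

text \<open>Call a triple \<open>(A, B, C)\<close> of vector fields an infinitesimal autotopism if
  \<open>dm(A(g), B(h)) = C(gh)\<close> for the product map \<open>m\<close>. The Moufang identity and the inverse property
  make \<open>(L\<^sub>x, R\<^sub>x, -M\<^sub>x)\<close>, \<open>(-M\<^sub>x, -L\<^sub>x, L\<^sub>x)\<close> and \<open>(-R\<^sub>x, -M\<^sub>x, R\<^sub>x)\<close> infinitesimal autotopisms, and
  these are closed under componentwise brackets. Summing the brackets of the three triples for
  \<open>x\<close> and \<open>y\<close> shows that \<open>(Y, Y, Y)\<close> with \<open>Y = Y(x;y)\<close> is an infinitesimal autotopism, so \<open>Y\<close> is a
  derivation of the loop and vanishes at \<open>e\<close>. Differentiating \<open>dm(Y(g), Y(h)) = Y(gh)\<close> in \<open>g\<close> at \<open>e\<close>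
  in the direction \<open>z\<close> gives \<open>[Y, L\<^sub>z] = -L\<^sub>D\<^sub>z\<close>, where \<open>D\<close> is the derivative of \<open>Y\<close> at \<open>e\<close>, and
  \<open>Dz = -[x,y,z]/6\<close> by the definition of the Yamaguti constants; similarly for \<open>R\<close>.\<close>

section \<open>Derivatives of power series\<close>

text \<open>Why the three triples suffice: a bracket does not change when both fields change sign,
  and up to signs the first slots of the triples are \<open>L\<close>, \<open>M\<close>,
  \<open>R\<close>, the second slots \<open>R\<close>, \<open>L\<close>, \<open>M\<close> and the
  third slots \<open>M\<close>, \<open>L\<close>, \<open>R\<close>. So in every slot the three
  brackets add up to \<open>6 Y\<close>. The sign in \<open>Dz = -[x,y,z]/6\<close> arises because
  the secondary functions are components of the bracket with its two fields exchanged; it cancels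
  the sign in \<open>[Y, L_z] = -L_Dz\<close>. The statement for \<open>M\<close> follows from those
  for \<open>L\<close> and \<open>R\<close> by linearity. Two obstacles shape the proof. Analyticity
  is given as unordered summability of a power series, so differentiability of all orders and the
  symmetry of second derivatives are first extracted from the coefficients; afterwards only these
  consequences are used. And the axioms hold only near the unit, so loop identities are stated along
  a filter, for functions tending to the unit; they can then be substituted into one another without
  shrinking neighbourhoods by hand.\<close>

lemma has_sum_sum:
  fixes f :: "'i \<Rightarrow> 'a \<Rightarrow> 'b::topological_comm_monoid_add"
  assumes "\<And>i. i \<in> I \<Longrightarrow> (f i has_sum s i) A"
  shows "((\<lambda>x. \<Sum>i\<in>I. f i x) has_sum (\<Sum>i\<in>I. s i)) A"
  using assms by (induction I rule: infinite_finite_induct) (auto intro: has_sum_add)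

text \<open>A Weierstrass test on the derivatives: the summable bounds \<open>M n\<close> make the
  tails of the derivative series small uniformly in the point, relative to
  \<open>norm h\<close>.\<close>

lemma has_derivative_suminf:
  fixes f :: "nat \<Rightarrow> 'a::real_normed_vector \<Rightarrow> 'b::banach"
  assumes S: "convex S" "open S"
    and f': "\<And>n x. x \<in> S \<Longrightarrow> (f n has_derivative f' n x) (at x)"
    and bound: "\<And>n x h. x \<in> S \<Longrightarrow> norm (f' n x h) \<le> M n * norm h"
    and M: "summable M"
    and sums: "\<And>x. x \<in> S \<Longrightarrow> (\<lambda>n. f n x) sums F x"
    and x: "x \<in> S"
  shows "(F has_derivative (\<lambda>h. \<Sum>n. f' n x h)) (at x)"
proof -
  have summ: "summable (\<lambda>n. f' n x h)" if "x \<in> S" for x h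
    by (rule summable_comparison_test[OF _ summable_mult2[OF M, of "norm h"]]) (use bound that in auto)
  have "\<exists>g. \<forall>x\<in>S. (\<lambda>n. f n x) sums g x \<and> (g has_derivative (\<lambda>h. \<Sum>n. f' n x h)) (at x within S)"
  proof (rule has_derivative_series[where f = f and f' = f' and l = "F x", OF S(1) _ _ x sums[OF x]])
    show "(f n has_derivative f' n x) (at x within S)" if "x \<in> S" for n x
      using f'[OF that] by (rule has_derivative_at_withinI)
    fix e :: real assume e: "e > 0"
    obtain N where N: "\<And>n. n \<ge> N \<Longrightarrow> norm (\<Sum>i. M (i + n)) < e"
      using suminf_exist_split[OF e M] by blast
    show "\<forall>\<^sub>F n in sequentially. \<forall>x\<in>S. \<forall>h. norm ((\<Sum>i<n. f' i x h) - (\<Sum>n. f' n x h)) \<le> e * norm h"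
      unfolding eventually_sequentially
    proof (intro exI allI impI ballI)
      fix n y and h :: 'a assume n: "N \<le> n" and y: "y \<in> S"
      have sM: "summable (\<lambda>i. M (i + n) * norm h)"
        using M by (intro summable_mult2) (simp add: summable_iff_shift)
      have "norm ((\<Sum>i<n. f' i y h) - (\<Sum>n. f' n y h)) = norm (\<Sum>i. f' (i + n) y h)"
        using suminf_minus_initial_segment[OF summ[OF y, of h], of n] by (simp add: norm_minus_commute)
      also have "\<dots> \<le> (\<Sum>i. M (i + n) * norm h)"
        using bound[OF y] by (intro norm_suminf_le sM) auto
      also have "\<dots> = (\<Sum>i. M (i + n)) * norm h"
        using M by (intro suminf_mult2[symmetric]) (simp add: summable_iff_shift)
      also have "\<dots> \<le> e * norm h"
        using N[OF n] by (intro mult_right_mono) auto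
      finally show "norm ((\<Sum>i<n. f' i y h) - (\<Sum>n. f' n y h)) \<le> e * norm h" .
    qed
  qed
  then obtain g where g: "\<And>x. x \<in> S \<Longrightarrow> (\<lambda>n. f n x) sums g x"
    "\<And>x. x \<in> S \<Longrightarrow> (g has_derivative (\<lambda>h. \<Sum>n. f' n x h)) (at x within S)" by blast
  \<comment> \<open>\<open>has_derivative_series\<close> yields only some sum \<open>g\<close>;
    uniqueness of limits identifies it with \<open>F\<close> on \<open>S\<close>.\<close>
  have "g y = F y" if "y \<in> S" for y using g(1)[OF that] sums[OF that] sums_unique2 by blast
  then show ?thesis
    using g(2)[OF x] S(2) x has_derivative_transform_within_open at_within_open by metis
qed

section \<open>Monomials over multi-indices: derivatives and bounds\<close>

abbreviation multi_indices :: "('a::euclidean_space \<Rightarrow> nat) set" where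
  "multi_indices \<equiv> Basis \<rightarrow>\<^sub>E UNIV"

definition monomial :: "('a::euclidean_space \<Rightarrow> nat) \<Rightarrow> 'a \<Rightarrow> real" where
  "monomial \<alpha> x = (\<Prod>b\<in>Basis. (x \<bullet> b) ^ \<alpha> b)"

text \<open>If \<open>\<alpha> i = 0\<close>, truncated subtraction leaves the exponent at 0, and
  the factor \<open>real (\<alpha> i)\<close> kills the summand.\<close>

definition monomial_deriv :: "('a::euclidean_space \<Rightarrow> nat) \<Rightarrow> 'a \<Rightarrow> 'a \<Rightarrow> real" where
  "monomial_deriv \<alpha> x v =
    (\<Sum>i\<in>Basis. (v \<bullet> i) * (real (\<alpha> i) * monomial (\<alpha>(i := \<alpha> i - 1)) x))"

lemma countable_multi_indices: "countable (multi_indices :: ('a::euclidean_space \<Rightarrow> nat) set)"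
  by (rule countable_PiE) auto

text \<open>Together with countability this gives a bijective enumeration by \<open>nat\<close>,
  which turns unordered sums into ordinary series.\<close>

lemma infinite_multi_indices: "infinite (multi_indices :: ('a::euclidean_space \<Rightarrow> nat) set)"
proof
  assume fin: "finite (multi_indices :: ('a \<Rightarrow> nat) set)"
  obtain b :: 'a where b: "b \<in> Basis" using nonempty_Basis by blast
  have "inj (\<lambda>n::nat. restrict (\<lambda>_. n) (Basis :: 'a set))"
    by (rule injI) (metis b restrict_apply')
  moreover have "range (\<lambda>n::nat. restrict (\<lambda>_. n) (Basis :: 'a set)) \<subseteq> multi_indices" by auto
  ultimately show False
    using fin by (metis finite_imageD finite_subset infinite_UNIV_nat)
qed

lemma monomial_fun_upd:
  fixes x :: "'a::euclidean_space"
  assumes "i \<in> Basis"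
  shows "monomial (\<alpha>(i := n)) x = (x \<bullet> i) ^ n * (\<Prod>j\<in>Basis - {i}. (x \<bullet> j) ^ \<alpha> j)"
  unfolding monomial_def using assms by (subst prod.remove[of _ i]) (auto intro!: prod.cong)

lemma has_derivative_monomial:
  fixes x a :: "'a::euclidean_space"
  shows "((\<lambda>x. monomial \<alpha> (x - a)) has_derivative monomial_deriv \<alpha> (x - a)) (at x)"
proof -
  have "((\<lambda>x. \<Prod>b\<in>Basis. ((x - a) \<bullet> b) ^ \<alpha> b) has_derivative
    (\<lambda>v. \<Sum>i\<in>Basis. (of_nat (\<alpha> i) * (v \<bullet> i) * ((x - a) \<bullet> i) ^ (\<alpha> i - 1))
      * (\<Prod>j\<in>Basis - {i}. ((x - a) \<bullet> j) ^ \<alpha> j))) (at x)"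
    by (auto intro!: derivative_eq_intros simp: fun_eq_iff)
  moreover have "(\<lambda>v. \<Sum>i\<in>Basis. (of_nat (\<alpha> i) * (v \<bullet> i) * ((x - a) \<bullet> i) ^ (\<alpha> i - 1))
      * (\<Prod>j\<in>Basis - {i}. ((x - a) \<bullet> j) ^ \<alpha> j)) = monomial_deriv \<alpha> (x - a)"
    unfolding monomial_deriv_def by (auto simp: monomial_fun_upd fun_eq_iff intro!: sum.cong)
  ultimately show ?thesis unfolding monomial_def by simp
qed

lemma abs_monomial_le:
  fixes x :: "'a::euclidean_space"
  assumes "norm x \<le> s"
  shows "\<bar>monomial \<alpha> x\<bar> \<le> s ^ (\<Sum>b\<in>Basis. \<alpha> b)"
proof -
  have "\<bar>monomial \<alpha> x\<bar> = (\<Prod>b\<in>Basis. \<bar>x \<bullet> b\<bar> ^ \<alpha> b)"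
    by (simp add: monomial_def abs_prod power_abs)
  also have "\<dots> \<le> (\<Prod>b\<in>(Basis::'a set). s ^ \<alpha> b)"
    using assms Basis_le_norm[of _ x] by (intro prod_mono) (auto intro!: power_mono intro: order_trans)
  finally show ?thesis by (simp add: power_sum)
qed

text \<open>Halving the radius pays for the factor \<open>\<alpha> i\<close>: in total degree
  \<open>n\<close> it is at most \<open>2 ^ n\<close>, and \<open>2 ^ n\<close> times
  \<open>(s / 2) ^ (n - 1)\<close> is \<open>2 / s * s ^ n\<close>.\<close>

lemma abs_monomial_deriv_coeff_le:
  fixes x :: "'a::euclidean_space"
  assumes x: "norm x \<le> s / 2" and s: "s > 0" and i: "i \<in> Basis"
  shows "\<bar>real (\<alpha> i) * monomial (\<alpha>(i := \<alpha> i - 1)) x\<bar> \<le> 2 / s * s ^ (\<Sum>b\<in>Basis. \<alpha> b)"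
proof (cases "\<alpha> i")
  case 0
  then show ?thesis using s by simp
next
  case (Suc k)
  define n where "n = (\<Sum>b\<in>Basis. \<alpha> b)"
  define n' where "n' = (\<Sum>b\<in>Basis. (\<alpha>(i := \<alpha> i - 1)) b)"
  have "n = \<alpha> i + (\<Sum>b\<in>Basis - {i}. \<alpha> b)" unfolding n_def using i by (subst sum.remove[of _ i]) auto
  moreover have "n' = k + (\<Sum>b\<in>Basis - {i}. \<alpha> b)" unfolding n'_def using i Suc
    by (subst sum.remove[of _ i]) (auto intro!: sum.cong)
  ultimately have n: "n = Suc n'" "\<alpha> i \<le> n" using Suc by auto
  have "real (\<alpha> i) \<le> 2 ^ n" using n(2) of_nat_less_two_power[of n, where 'a=real] by linarith
  then have "\<bar>real (\<alpha> i) * monomial (\<alpha>(i := \<alpha> i - 1)) x\<bar> \<le> 2 ^ n * (s / 2) ^ n'"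
    unfolding abs_mult n'_def by (intro mult_mono abs_monomial_le x) auto
  also have "\<dots> = 2 / s * s ^ n" using s by (simp add: n(1) power_divide)
  finally show ?thesis by (simp add: n_def)
qed

section \<open>Convergent power series and their termwise derivatives\<close>

definition power_series_at ::
  "('a::euclidean_space \<Rightarrow> 'b::real_normed_vector) \<Rightarrow> 'a \<Rightarrow> (('a \<Rightarrow> nat) \<Rightarrow> 'b) \<Rightarrow> bool" where
  "power_series_at f a c \<longleftrightarrow>
    (\<exists>r>0. \<forall>x\<in>ball a r. ((\<lambda>\<alpha>. monomial \<alpha> (x - a) *\<^sub>R c \<alpha>) has_sum f x) multi_indices)"

text \<open>Naming the coefficients, which \<open>real_analytic_at\<close> hides, makes it possible
  to follow them through repeated differentiation.\<close>

lemma real_analytic_at_iff_power_series: "real_analytic_at f a \<longleftrightarrow> (\<exists>c. power_series_at f a c)"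
  by (simp add: real_analytic_at_def power_series_at_def monomial_def)

text \<open>The index shift of a directional derivative: the monomial with exponent
  \<open>\<alpha>\<close> arises from the one whose exponent is larger by one at \<open>i\<close>,
  and brings down that larger exponent as a factor.\<close>

definition deriv_coeff ::
  "'a \<Rightarrow> (('a::euclidean_space \<Rightarrow> nat) \<Rightarrow> 'b::real_normed_vector) \<Rightarrow> ('a \<Rightarrow> nat) \<Rightarrow> 'b" where
  "deriv_coeff v c \<alpha> = (\<Sum>i\<in>Basis. (v \<bullet> i) *\<^sub>R (real (\<alpha> i + 1) *\<^sub>R c (\<alpha>(i := \<alpha> i + 1))))"

text \<open>At the diagonal point with all coordinates \<open>s\<close>, every monomial equals
  \<open>s\<close> to its total degree, so convergence at this single point controls all
  coefficients.\<close>

lemma power_series_at_abs_summable: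
  fixes f :: "'a::euclidean_space \<Rightarrow> 'b::euclidean_space"
  assumes "power_series_at f a c"
  obtains s where "s > 0"
    "(\<lambda>\<alpha>. s ^ (\<Sum>b\<in>Basis. \<alpha> b) * norm (c \<alpha>)) summable_on multi_indices"
    "\<And>x. x \<in> ball a s \<Longrightarrow> ((\<lambda>\<alpha>. monomial \<alpha> (x - a) *\<^sub>R c \<alpha>) has_sum f x) multi_indices"
proof -
  from assms obtain r where r: "r > 0" and
    f: "\<And>x. x \<in> ball a r \<Longrightarrow> ((\<lambda>\<alpha>. monomial \<alpha> (x - a) *\<^sub>R c \<alpha>) has_sum f x) multi_indices"
    unfolding power_series_at_def by blast
  \<comment> \<open>The diagonal point has norm at most \<open>DIM('a) * s\<close>, which this
    choice makes \<open>r / 2\<close>.\<close>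
  define s where "s = r / (2 * real (DIM('a)))"
  have "1 \<le> real (DIM('a)) * 2" using DIM_positive[where 'a='a] by linarith
  then have s: "s > 0" "s \<le> r" using r by (auto simp: s_def field_simps)
  define x :: 'a where "x = (\<Sum>b\<in>Basis. s *\<^sub>R b)"
  have "norm x \<le> (\<Sum>b\<in>(Basis::'a set). norm (s *\<^sub>R b))" unfolding x_def by (rule norm_sum)
  also have "\<dots> = r / 2" using s by (simp add: s_def)
  also have "\<dots> < r" using r by simp
  finally have "a + x \<in> ball a r" by (simp add: dist_norm)
  from f[OF this] have "(\<lambda>\<alpha>. monomial \<alpha> x *\<^sub>R c \<alpha>) summable_on multi_indices"
    by (auto simp: summable_on_def)
  moreover have xb: "x \<bullet> b = s" if "b \<in> Basis" for b
    unfolding x_def using that by (simp add: inner_sum_left inner_Basis if_distrib sum.delta cong: if_cong)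
  moreover have "monomial \<alpha> x = s ^ (\<Sum>b\<in>Basis. \<alpha> b)" for \<alpha>
    unfolding monomial_def by (simp add: xb power_sum)
  ultimately have sc: "(\<lambda>\<alpha>. s ^ (\<Sum>b\<in>Basis. \<alpha> b) *\<^sub>R c \<alpha>) summable_on multi_indices" by simp
  \<comment> \<open>Unordered summability of reals is absolute, so it is absolute in every
    coordinate, and the norm is at most the sum of the absolute coordinates.\<close>
  have "(\<lambda>\<alpha>. s ^ (\<Sum>b\<in>Basis. \<alpha> b) * (c \<alpha> \<bullet> d)) summable_on multi_indices" for d
    using summable_on_bounded_linear[OF bounded_linear_inner_left sc, of d] by simp
  then have "(\<lambda>\<alpha>. \<bar>s ^ (\<Sum>b\<in>Basis. \<alpha> b) * (c \<alpha> \<bullet> d)\<bar>) summable_on multi_indices" for d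
    using summable_on_iff_abs_summable_on_real by (metis (no_types, lifting) real_norm_def summable_on_cong)
  then have "(\<lambda>\<alpha>. \<Sum>d\<in>Basis. \<bar>s ^ (\<Sum>b\<in>Basis. \<alpha> b) * (c \<alpha> \<bullet> d)\<bar>) summable_on multi_indices"
    by (rule has_sum_imp_summable[OF has_sum_sum[OF has_sum_infsum]])
  then have "(\<lambda>\<alpha>. s ^ (\<Sum>b\<in>Basis. \<alpha> b) * norm (c \<alpha>)) summable_on multi_indices"
  proof (rule summable_on_comparison_test)
    fix \<alpha> :: "'a \<Rightarrow> nat"
    show "s ^ (\<Sum>b\<in>Basis. \<alpha> b) * norm (c \<alpha>) \<le> (\<Sum>d\<in>Basis. \<bar>s ^ (\<Sum>b\<in>Basis. \<alpha> b) * (c \<alpha> \<bullet> d)\<bar>)"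
      using s norm_le_l1[of "c \<alpha>"] by (simp add: abs_mult sum_distrib_left[symmetric])
  qed (use s in auto)
  with s f show ?thesis by (intro that[of s]) auto
qed

text \<open>The enumeration \<open>E\<close> gives a series that can be differentiated term by term
  on half the ball. Absolute convergence then allows the derivative to be resummed by the exponent
  that remains after differentiation.\<close>

lemma power_series_at_deriv:
  fixes f :: "'a::euclidean_space \<Rightarrow> 'b::euclidean_space"
  assumes "power_series_at f a c"
  shows "f differentiable (at a)"
    and "power_series_at (\<lambda>x. frechet_derivative f (at x) v) a (deriv_coeff v c)"
proof -
  from assms obtain s where s: "s > 0"
    and summ: "(\<lambda>\<alpha>. s ^ (\<Sum>b\<in>Basis. \<alpha> b) * norm (c \<alpha>)) summable_on multi_indices"
    and f: "\<And>x. x \<in> ball a s \<Longrightarrow> ((\<lambda>\<alpha>. monomial \<alpha> (x - a) *\<^sub>R c \<alpha>) has_sum f x) multi_indices"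
    by (rule power_series_at_abs_summable) blast
  define E where "E = from_nat_into (multi_indices :: ('a \<Rightarrow> nat) set)"
  have E: "bij_betw E UNIV multi_indices"
    unfolding E_def by (intro bij_betw_from_nat_into countable_multi_indices infinite_multi_indices)
  \<comment> \<open>The majorant for one coordinate direction; adding up the directions costs the
    factor \<open>DIM('a)\<close>.\<close>
  define C where "C \<alpha> = 2 / s * (s ^ (\<Sum>b\<in>Basis. \<alpha> b) * norm (c \<alpha>))" for \<alpha>
  have C: "C summable_on multi_indices" unfolding C_def using summ by (intro summable_on_cmult_right)
  have bound1: "norm ((real (\<alpha> i) * monomial (\<alpha>(i := \<alpha> i - 1)) (x - a)) *\<^sub>R c \<alpha>) \<le> C \<alpha>"
    if "x \<in> ball a (s / 2)" "i \<in> Basis" for x i \<alpha>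
  proof -
    have "norm (x - a) \<le> s / 2" using that by (simp add: dist_norm norm_minus_commute)
    from mult_right_mono[OF abs_monomial_deriv_coeff_le[OF this s that(2), of \<alpha>] norm_ge_zero[of "c \<alpha>"]]
    show ?thesis by (simp add: C_def)
  qed
  have C0: "C \<alpha> \<ge> 0" for \<alpha> using s by (simp add: C_def)
  have bound: "norm (monomial_deriv \<alpha> (x - a) h *\<^sub>R c \<alpha>) \<le> (real (DIM('a)) * C \<alpha>) * norm h"
    if "x \<in> ball a (s / 2)" for x h \<alpha>
  proof -
    have "norm (monomial_deriv \<alpha> (x - a) h *\<^sub>R c \<alpha>) =
      norm (\<Sum>i\<in>Basis. (h \<bullet> i) *\<^sub>R ((real (\<alpha> i) * monomial (\<alpha>(i := \<alpha> i - 1)) (x - a)) *\<^sub>R c \<alpha>))"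
      by (simp add: monomial_deriv_def scaleR_sum_left)
    also have "\<dots> \<le> (\<Sum>i\<in>(Basis::'a set). norm h * C \<alpha>)"
    proof (intro sum_norm_le)
      fix i :: 'a assume i: "i \<in> Basis"
      show "norm ((h \<bullet> i) *\<^sub>R ((real (\<alpha> i) * monomial (\<alpha>(i := \<alpha> i - 1)) (x - a)) *\<^sub>R c \<alpha>)) \<le> norm h * C \<alpha>"
        using mult_mono[OF Basis_le_norm[OF i, of h] bound1[OF that i, of \<alpha>]] by (simp add: abs_mult mult.assoc)
    qed
    finally show ?thesis by (simp add: mult_ac)
  qed
  have sC: "summable (\<lambda>n. real (DIM('a)) * C (E n))"
    using C summable_on_reindex_bij_betw[OF E, of C] by (intro summable_mult summable_on_imp_summable) simp
  have deriv: "(f has_derivative (\<lambda>h. \<Sum>n. monomial_deriv (E n) (x - a) h *\<^sub>R c (E n))) (at x)"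
    if x: "x \<in> ball a (s / 2)" for x
  proof (rule has_derivative_suminf[where S = "ball a (s / 2)" and M = "\<lambda>n. real (DIM('a)) * C (E n)"
        and f = "\<lambda>n x. monomial (E n) (x - a) *\<^sub>R c (E n)"])
    fix n y assume y: "y \<in> ball a (s / 2)"
    show "((\<lambda>x. monomial (E n) (x - a) *\<^sub>R c (E n)) has_derivative
        (\<lambda>h. monomial_deriv (E n) (y - a) h *\<^sub>R c (E n))) (at y)"
      by (intro has_derivative_scaleR_left has_derivative_monomial)
  next
    fix y assume y: "y \<in> ball a (s / 2)"
    then have "y \<in> ball a s" using s by simp
    from f[OF this] show "(\<lambda>n. monomial (E n) (y - a) *\<^sub>R c (E n)) sums f y"
      using has_sum_reindex_bij_betw[OF E, of "\<lambda>\<alpha>. monomial \<alpha> (y - a) *\<^sub>R c \<alpha>"]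
      by (intro has_sum_imp_sums) simp
  qed (use bound x sC in auto)
  show "f differentiable (at a)" using deriv[of a] s by (auto simp: differentiable_def)
  have "((\<lambda>\<alpha>. monomial \<alpha> (x - a) *\<^sub>R deriv_coeff v c \<alpha>) has_sum frechet_derivative f (at x) v) multi_indices"
    if x: "x \<in> ball a (s / 2)" for x
  proof -
    \<comment> \<open>\<open>t i\<close> holds the terms of the partial derivative in direction
      \<open>i\<close>, still indexed by the exponent before differentiation.\<close>
    define t where "t i \<alpha> = (real (\<alpha> i) * monomial (\<alpha>(i := \<alpha> i - 1)) (x - a)) *\<^sub>R c \<alpha>" for i \<alpha>
    have t: "t i summable_on multi_indices" if "i \<in> Basis" for i
    proof (rule abs_summable_summable, rule summable_on_comparison_test[OF C])
      fix \<alpha> :: "'a \<Rightarrow> nat"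
      show "norm (t i \<alpha>) \<le> C \<alpha>" unfolding t_def by (rule bound1[OF x that])
    qed simp
    then have "((\<lambda>\<alpha>. \<Sum>i\<in>Basis. (v \<bullet> i) *\<^sub>R t i \<alpha>) has_sum (\<Sum>i\<in>Basis. (v \<bullet> i) *\<^sub>R infsum (t i) multi_indices)) multi_indices"
      by (rule has_sum_sum[OF has_sum_scaleR[OF has_sum_infsum]])
    moreover have "(\<Sum>i\<in>Basis. (v \<bullet> i) *\<^sub>R t i \<alpha>) = monomial_deriv \<alpha> (x - a) v *\<^sub>R c \<alpha>" for \<alpha>
      by (simp add: monomial_deriv_def t_def scaleR_sum_left)
    ultimately have hs: "((\<lambda>\<alpha>. monomial_deriv \<alpha> (x - a) v *\<^sub>R c \<alpha>) has_sum (\<Sum>i\<in>Basis. (v \<bullet> i) *\<^sub>R infsum (t i) multi_indices)) multi_indices"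
      by simp
    then have "(\<lambda>n. monomial_deriv (E n) (x - a) v *\<^sub>R c (E n)) sums (\<Sum>i\<in>Basis. (v \<bullet> i) *\<^sub>R infsum (t i) multi_indices)"
      using has_sum_reindex_bij_betw[OF E, of "\<lambda>\<alpha>. monomial_deriv \<alpha> (x - a) v *\<^sub>R c \<alpha>"]
      by (intro has_sum_imp_sums) simp
    from sums_unique[OF this] have D: "frechet_derivative f (at x) v = (\<Sum>i\<in>Basis. (v \<bullet> i) *\<^sub>R infsum (t i) multi_indices)"
      using fun_cong[OF frechet_derivative_at[OF deriv[OF x]], of v] by simp
    have "((\<lambda>\<alpha>. (real (\<alpha> i + 1) * monomial \<alpha> (x - a)) *\<^sub>R c (\<alpha>(i := \<alpha> i + 1))) has_sum infsum (t i) multi_indices) multi_indices"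
      if i: "i \<in> Basis" for i
    proof -
      have inj: "inj_on (\<lambda>\<alpha>::'a \<Rightarrow> nat. \<alpha>(i := \<alpha> i + 1)) multi_indices"
      proof (rule inj_onI)
        fix \<alpha> \<beta> :: "'a \<Rightarrow> nat" assume *: "\<alpha>(i := \<alpha> i + 1) = \<beta>(i := \<beta> i + 1)"
        show "\<alpha> = \<beta>"
        proof
          fix b show "\<alpha> b = \<beta> b" using fun_cong[OF *, of b] by (cases "b = i") auto
        qed
      qed
      have img: "(\<lambda>\<alpha>. \<alpha>(i := \<alpha> i + 1)) ` multi_indices = {\<alpha> \<in> multi_indices. \<alpha> i \<noteq> 0}"
      proof (intro set_eqI iffI)
        fix \<alpha> assume a: "\<alpha> \<in> {\<alpha> \<in> (multi_indices :: ('a \<Rightarrow> nat) set). \<alpha> i \<noteq> 0}"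
        then have "\<alpha> = (\<alpha>(i := \<alpha> i - 1))(i := (\<alpha>(i := \<alpha> i - 1)) i + 1)" by auto
        moreover have "\<alpha>(i := \<alpha> i - 1) \<in> multi_indices" using a i by (auto simp: PiE_iff extensional_def)
        ultimately show "\<alpha> \<in> (\<lambda>\<alpha>. \<alpha>(i := \<alpha> i + 1)) ` multi_indices" by blast
      qed (use i in \<open>auto simp: PiE_iff extensional_def\<close>)
      \<comment> \<open>The terms with \<open>\<alpha> i = 0\<close> vanish; the others are indexed
        by the image of the shift, and pulling back along it produces the coefficients of
        \<open>deriv_coeff\<close>.\<close>
      have "(t i has_sum infsum (t i) multi_indices) multi_indices \<longleftrightarrow>
          (t i has_sum infsum (t i) multi_indices) {\<alpha> \<in> multi_indices. \<alpha> i \<noteq> 0}"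
        by (rule has_sum_cong_neutral) (auto simp: t_def)
      then have "(t i has_sum infsum (t i) multi_indices) {\<alpha> \<in> multi_indices. \<alpha> i \<noteq> 0}"
        using t[OF i] by simp
      then have "((t i \<circ> (\<lambda>\<alpha>. \<alpha>(i := \<alpha> i + 1))) has_sum infsum (t i) multi_indices) multi_indices"
        by (subst has_sum_reindex[OF inj, symmetric]) (simp add: img[simplified])
      then show ?thesis by (simp add: t_def o_def)
    qed
    then have "((\<lambda>\<alpha>. \<Sum>i\<in>Basis. (v \<bullet> i) *\<^sub>R ((real (\<alpha> i + 1) * monomial \<alpha> (x - a)) *\<^sub>R c (\<alpha>(i := \<alpha> i + 1))))
        has_sum (\<Sum>i\<in>Basis. (v \<bullet> i) *\<^sub>R infsum (t i) multi_indices)) multi_indices"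
      by (rule has_sum_sum[OF has_sum_scaleR])
    moreover have "(\<Sum>i\<in>Basis. (v \<bullet> i) *\<^sub>R ((real (\<alpha> i + 1) * monomial \<alpha> (x - a)) *\<^sub>R c (\<alpha>(i := \<alpha> i + 1))))
        = monomial \<alpha> (x - a) *\<^sub>R deriv_coeff v c \<alpha>" for \<alpha>
      by (simp add: deriv_coeff_def scaleR_sum_right mult_ac)
    ultimately show ?thesis by (simp add: D)
  qed
  then show "power_series_at (\<lambda>x. frechet_derivative f (at x) v) a (deriv_coeff v c)"
    unfolding power_series_at_def using s by (intro exI[of _ "s / 2"]) auto
qed


text \<open>At the centre every monomial but the constant one has a factor 0. Applied to
  derivatives, this reads off their values at \<open>a\<close> as coefficients.\<close>

lemma power_series_at_center:
  fixes f :: "'a::euclidean_space \<Rightarrow> 'b::real_normed_vector"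
  assumes "power_series_at f a c"
  shows "f a = c (\<lambda>b\<in>Basis. 0)"
proof -
  from assms obtain r where "r > 0"
    "\<And>x. x \<in> ball a r \<Longrightarrow> ((\<lambda>\<alpha>. monomial \<alpha> (x - a) *\<^sub>R c \<alpha>) has_sum f x) multi_indices"
    unfolding power_series_at_def by blast
  from this(2)[of a] this(1)
  have *: "((\<lambda>\<alpha>. monomial \<alpha> (0::'a) *\<^sub>R c \<alpha>) has_sum f a) multi_indices" by simp
  have "monomial \<alpha> (0::'a) = 0" if "\<alpha> \<in> multi_indices - {\<lambda>b\<in>Basis. 0}" for \<alpha>
  proof -
    from that obtain b where "b \<in> Basis" "\<alpha> b \<noteq> 0" by (force simp: PiE_iff extensional_def fun_eq_iff)
    then show ?thesis unfolding monomial_def by (auto simp: prod_zero_iff)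
  qed
  then have "((\<lambda>\<alpha>. monomial \<alpha> (0::'a) *\<^sub>R c \<alpha>) has_sum f a) multi_indices \<longleftrightarrow>
      ((\<lambda>\<alpha>. monomial \<alpha> (0::'a) *\<^sub>R c \<alpha>) has_sum f a) {\<lambda>b\<in>Basis. 0}"
    by (intro has_sum_cong_neutral) auto
  with * have "((\<lambda>\<alpha>. monomial \<alpha> (0::'a) *\<^sub>R c \<alpha>) has_sum f a) {\<lambda>b\<in>Basis. 0}" by blast
  from has_sum_unique[OF this has_sum_finite] show ?thesis by (simp add: monomial_def)
qed

lemma real_analytic_at_imp_differentiable:
  fixes f :: "'a::euclidean_space \<Rightarrow> 'b::euclidean_space"
  shows "real_analytic_at f a \<Longrightarrow> f differentiable (at a)"
  using power_series_at_deriv(1) real_analytic_at_iff_power_series by blast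

lemma real_analytic_at_frechet_derivative:
  fixes f :: "'a::euclidean_space \<Rightarrow> 'b::euclidean_space"
  shows "real_analytic_at f a \<Longrightarrow> real_analytic_at (\<lambda>x. frechet_derivative f (at x) v) a"
  using power_series_at_deriv(2) real_analytic_at_iff_power_series by blast

text \<open>Both sides are read off the coefficients of degree two of the power series.\<close>

lemma real_analytic_at_second_derivative_symmetric:
  fixes f :: "'a::euclidean_space \<Rightarrow> 'b::euclidean_space"
  assumes "real_analytic_at f a"
  shows "frechet_derivative (\<lambda>x. frechet_derivative f (at x) v) (at a) w =
    frechet_derivative (\<lambda>x. frechet_derivative f (at x) w) (at a) v"
proof -
  from assms obtain c where c: "power_series_at f a c" by (auto simp: real_analytic_at_iff_power_series)
  define z :: "'a \<Rightarrow> nat" where "z = (\<lambda>b\<in>Basis. 0)"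
  \<comment> \<open>The mixed second partial derivative at \<open>a\<close> in the directions
    \<open>i\<close> and \<open>j\<close>: the exponent is one at \<open>i\<close> plus one at
    \<open>j\<close>, and the factor 2 comes from differentiating a square twice.\<close>
  define C where "C i j = real (if i = j then 2 else 1) *\<^sub>R c ((z(j := 1))(i := (z(j := 1)) i + 1))" for i j
  have *: "frechet_derivative (\<lambda>x. frechet_derivative f (at x) v) (at a) w =
    (\<Sum>j\<in>Basis. \<Sum>i\<in>Basis. ((w \<bullet> j) * (v \<bullet> i)) *\<^sub>R C i j)" for v w
  proof -
    have "frechet_derivative (\<lambda>x. frechet_derivative f (at x) v) (at a) w = deriv_coeff w (deriv_coeff v c) z"
      unfolding z_def by (intro power_series_at_center power_series_at_deriv(2) c)
    also have "\<dots> = (\<Sum>j\<in>Basis. (w \<bullet> j) *\<^sub>R (\<Sum>i\<in>Basis. (v \<bullet> i) *\<^sub>R C i j))"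
      unfolding deriv_coeff_def[of w] deriv_coeff_def[of v] C_def
      by (auto simp: z_def scaleR_sum_right intro!: sum.cong)
    finally show ?thesis by (simp add: scaleR_sum_right)
  qed
  have "C i j = C j i" if "i \<in> Basis" "j \<in> Basis" for i j
    using that by (cases "i = j") (auto simp: C_def z_def fun_upd_twist)
  then show ?thesis unfolding * by (subst sum.swap) (auto intro!: sum.cong simp: mult.commute)
qed

section \<open>Elementary rules for Frechet derivatives\<close>

lemma frechet_derivative_has_derivative:
  "f differentiable (at x) \<Longrightarrow> (f has_derivative frechet_derivative f (at x)) (at x)"
  using frechet_derivative_works by blast

lemma frechet_derivative_eqI:
  "(f has_derivative f') (at x) \<Longrightarrow> frechet_derivative f (at x) v = f' v"
  using frechet_derivative_at by metis

lemma frechet_derivative_cong_open: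
  assumes "open S" "x \<in> S" "\<And>y. y \<in> S \<Longrightarrow> f y = g y" "f differentiable (at x)"
  shows "frechet_derivative g (at x) = frechet_derivative f (at x)"
  using frechet_derivative_transform_within_open[OF assms(4,1,2)] assms(3) by metis

lemma differentiable_cong_open:
  assumes "open S" "x \<in> S" "\<And>y. y \<in> S \<Longrightarrow> f y = g y" "f differentiable (at x)"
  shows "g differentiable (at x)"
  using assms has_derivative_transform_within_open unfolding differentiable_def by metis

lemma frechet_derivative_Basis_expansion:
  fixes f :: "'a::euclidean_space \<Rightarrow> 'b::real_normed_vector"
  assumes "f differentiable (at x)"
  shows "frechet_derivative f (at x) v = (\<Sum>b\<in>Basis. (v \<bullet> b) *\<^sub>R frechet_derivative f (at x) b)"
proof -
  interpret linear "frechet_derivative f (at x)" using linear_frechet_derivative[OF assms] .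
  have "frechet_derivative f (at x) v = frechet_derivative f (at x) (\<Sum>b\<in>Basis. (v \<bullet> b) *\<^sub>R b)"
    by (simp add: euclidean_representation)
  then show ?thesis by (simp add: sum scaleR)
qed

section \<open>Smooth maps\<close>

text \<open>With the direction \<open>v\<close> fixed, every iterated derivative has the type of
  \<open>f\<close> again, which makes recursion on \<open>k\<close> possible.\<close>

primrec times_differentiable_on ::
  "nat \<Rightarrow> ('a::euclidean_space \<Rightarrow> 'b::real_normed_vector) \<Rightarrow> 'a set \<Rightarrow> bool" where
  "times_differentiable_on 0 f S \<longleftrightarrow> True"
| "times_differentiable_on (Suc k) f S \<longleftrightarrow> (\<forall>x\<in>S. f differentiable (at x)) \<and>
    (\<forall>v. times_differentiable_on k (\<lambda>x. frechet_derivative f (at x) v) S)"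

definition smooth_on ::
  "('a::euclidean_space \<Rightarrow> 'b::real_normed_vector) \<Rightarrow> 'a set \<Rightarrow> bool" where
  "smooth_on f S \<longleftrightarrow> (\<forall>k. times_differentiable_on k f S)"

lemma times_differentiable_on_cong:
  assumes "open S" "times_differentiable_on k f S" "\<And>x. x \<in> S \<Longrightarrow> f x = g x"
  shows "times_differentiable_on k g S"
  using assms(2,3)
proof (induction k arbitrary: f g)
  case (Suc k)
  have "times_differentiable_on k (\<lambda>x. frechet_derivative g (at x) v) S" for v
  proof (rule Suc.IH[of "\<lambda>x. frechet_derivative f (at x) v"])
    show "frechet_derivative f (at x) v = frechet_derivative g (at x) v" if "x \<in> S" for x
      using frechet_derivative_cong_open[OF \<open>open S\<close> that, of f g] Suc.prems that by simp
  qed (use Suc.prems in simp)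
  then show ?case
    using Suc.prems differentiable_cong_open[OF \<open>open S\<close>, of _ f g] by simp
qed simp

lemma times_differentiable_on_Suc_imp:
  "times_differentiable_on (Suc k) f S \<Longrightarrow> times_differentiable_on k f S"
  by (induction k arbitrary: f) auto

lemma times_differentiable_on_const: "times_differentiable_on k (\<lambda>x. c) S"
  by (induction k arbitrary: c) auto

lemma times_differentiable_on_add:
  assumes "open S" "times_differentiable_on k f S" "times_differentiable_on k g S"
  shows "times_differentiable_on k (\<lambda>x. f x + g x) S"
  using assms(2,3)
proof (induction k arbitrary: f g)
  case (Suc k)
  have "times_differentiable_on k (\<lambda>x. frechet_derivative (\<lambda>x. f x + g x) (at x) v) S" for v
  proof (rule times_differentiable_on_cong[OF \<open>open S\<close> Suc.IH])
    fix x assume "x \<in> S"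
    then show "frechet_derivative f (at x) v + frechet_derivative g (at x) v =
        frechet_derivative (\<lambda>x. f x + g x) (at x) v"
      using Suc.prems by (intro frechet_derivative_eqI[symmetric] has_derivative_add
          frechet_derivative_has_derivative) auto
  qed (use Suc.prems in auto)
  then show ?case using Suc.prems by auto
qed simp

lemma times_differentiable_on_bounded_linear:
  assumes "open S" "bounded_linear h" "times_differentiable_on k f S"
  shows "times_differentiable_on k (\<lambda>x. h (f x)) S"
  using assms(3)
proof (induction k arbitrary: f)
  case (Suc k)
  have hd: "((\<lambda>x. h (f x)) has_derivative (\<lambda>v. h (frechet_derivative f (at x) v))) (at x)" if "x \<in> S" for x
    using Suc.prems that by (intro bounded_linear.has_derivative[OF assms(2)]
          frechet_derivative_has_derivative) auto
  have "times_differentiable_on k (\<lambda>x. frechet_derivative (\<lambda>x. h (f x)) (at x) v) S" for v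
    using Suc.prems by (intro times_differentiable_on_cong[OF \<open>open S\<close> Suc.IH])
      (auto simp: frechet_derivative_eqI[OF hd])
  then show ?case using hd by (auto simp: differentiable_def)
qed simp

lemma times_differentiable_on_scaleR:
  fixes f :: "'a::euclidean_space \<Rightarrow> real"
  assumes "open S" "times_differentiable_on k f S" "times_differentiable_on k g S"
  shows "times_differentiable_on k (\<lambda>x. f x *\<^sub>R g x) S"
  using assms(2,3)
proof (induction k arbitrary: f g)
  case (Suc k)
  have hd: "((\<lambda>x. f x *\<^sub>R g x) has_derivative
      (\<lambda>v. f x *\<^sub>R frechet_derivative g (at x) v + frechet_derivative f (at x) v *\<^sub>R g x)) (at x)"
    if "x \<in> S" for x
    using Suc.prems that by (intro has_derivative_scaleR frechet_derivative_has_derivative) auto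
  have "times_differentiable_on k (\<lambda>x. frechet_derivative (\<lambda>x. f x *\<^sub>R g x) (at x) v) S" for v
  proof (rule times_differentiable_on_cong[OF \<open>open S\<close> times_differentiable_on_add[OF \<open>open S\<close>]])
    \<comment> \<open>Each term of the product rule contains an undifferentiated factor; its order
      is lowered to \<open>k\<close> to fit the induction hypothesis.\<close>
    have "times_differentiable_on k f S" "times_differentiable_on k g S"
      using Suc.prems times_differentiable_on_Suc_imp by blast+
    with Suc.prems show "times_differentiable_on k (\<lambda>x. f x *\<^sub>R frechet_derivative g (at x) v) S"
      "times_differentiable_on k (\<lambda>x. frechet_derivative f (at x) v *\<^sub>R g x) S"
      by (auto intro!: Suc.IH)
  qed (auto simp: frechet_derivative_eqI[OF hd])
  then show ?case using hd by (auto simp: differentiable_def)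
qed simp

text \<open>Because \<open>i\<close> is linear, the chain rule differentiates \<open>f\<close> in
  the constant direction \<open>i v\<close>, so the induction stays within fixed directions. It
  serves for the slices \<open>(0, g)\<close> and \<open>(g, 0)\<close> of the product.\<close>

lemma times_differentiable_on_compose_linear:
  fixes f :: "'b::euclidean_space \<Rightarrow> 'c::real_normed_vector"
  assumes "open S" "bounded_linear i" "\<And>x. x \<in> S \<Longrightarrow> i x \<in> T" "times_differentiable_on k f T"
  shows "times_differentiable_on k (\<lambda>x. f (i x)) S"
  using assms(4)
proof (induction k arbitrary: f)
  case (Suc k)
  have hd: "((\<lambda>x. f (i x)) has_derivative (\<lambda>v. frechet_derivative f (at (i x)) (i v))) (at x)"
    if "x \<in> S" for x
    using Suc.prems that assms(3) by (intro has_derivative_compose[OF bounded_linear_imp_has_derivative[OF assms(2)]]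
          frechet_derivative_has_derivative) auto
  have "times_differentiable_on k (\<lambda>x. frechet_derivative (\<lambda>x. f (i x)) (at x) v) S" for v
    using Suc.prems by (intro times_differentiable_on_cong[OF \<open>open S\<close>
        Suc.IH[of "\<lambda>y. frechet_derivative f (at y) (i v)"]]) (auto simp: frechet_derivative_eqI[OF hd])
  then show ?case using hd by (auto simp: differentiable_def)
qed simp

lemma real_analytic_times_differentiable_on:
  fixes f :: "'a::euclidean_space \<Rightarrow> 'b::euclidean_space"
  assumes "\<And>x. x \<in> S \<Longrightarrow> real_analytic_at f x"
  shows "times_differentiable_on k f S"
  using assms
  by (induction k arbitrary: f)
    (auto intro: real_analytic_at_imp_differentiable real_analytic_at_frechet_derivative)

lemma smooth_onD:
  assumes "smooth_on f S"
  shows "x \<in> S \<Longrightarrow> f differentiable (at x)"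
    and "smooth_on (\<lambda>x. frechet_derivative f (at x) v) S"
  using assms unfolding smooth_on_def by (metis times_differentiable_on.simps(2))+

lemma smooth_on_cong: "open S \<Longrightarrow> smooth_on f S \<Longrightarrow> (\<And>x. x \<in> S \<Longrightarrow> f x = g x) \<Longrightarrow> smooth_on g S"
  unfolding smooth_on_def using times_differentiable_on_cong by blast

lemma smooth_on_add: "open S \<Longrightarrow> smooth_on f S \<Longrightarrow> smooth_on g S \<Longrightarrow> smooth_on (\<lambda>x. f x + g x) S"
  unfolding smooth_on_def using times_differentiable_on_add by blast

lemma smooth_on_bounded_linear:
  "open S \<Longrightarrow> bounded_linear h \<Longrightarrow> smooth_on f S \<Longrightarrow> smooth_on (\<lambda>x. h (f x)) S"
  unfolding smooth_on_def using times_differentiable_on_bounded_linear by blast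

lemma smooth_on_minus: "open S \<Longrightarrow> smooth_on f S \<Longrightarrow> smooth_on (\<lambda>x. - f x) S"
  using smooth_on_bounded_linear[OF _ bounded_linear_minus[OF bounded_linear_ident]] .

lemma smooth_on_diff: "open S \<Longrightarrow> smooth_on f S \<Longrightarrow> smooth_on g S \<Longrightarrow> smooth_on (\<lambda>x. f x - g x) S"
  using smooth_on_add[of S f "\<lambda>x. - g x"] smooth_on_minus[of S g] by simp

lemma smooth_on_sum:
  assumes "open S" "\<And>i. i \<in> I \<Longrightarrow> smooth_on (f i) S"
  shows "smooth_on (\<lambda>x. \<Sum>i\<in>I. f i x) S"
  using assms(2)
proof (induction I rule: infinite_finite_induct)
  case (insert i I)
  then show ?case using smooth_on_add[OF assms(1)] by auto
qed (auto simp: smooth_on_def times_differentiable_on_const)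

text \<open>Expanding the variable direction in the basis reduces the claim to fixed directions with
  smooth scalar coefficients.\<close>

lemma smooth_on_frechet_derivative:
  fixes f :: "'a::euclidean_space \<Rightarrow> 'b::real_normed_vector"
  assumes "open S" "smooth_on f S" "smooth_on X S"
  shows "smooth_on (\<lambda>x. frechet_derivative f (at x) (X x)) S"
proof (rule smooth_on_cong[OF assms(1) smooth_on_sum[OF assms(1)]])
  show "smooth_on (\<lambda>x. (X x \<bullet> b) *\<^sub>R frechet_derivative f (at x) b) S" for b
    using smooth_onD(2)[OF assms(2), of b]
      smooth_on_bounded_linear[OF assms(1) bounded_linear_inner_left assms(3), of b]
    unfolding smooth_on_def by (auto intro: times_differentiable_on_scaleR[OF assms(1)])
  show "(\<Sum>b\<in>Basis. (X x \<bullet> b) *\<^sub>R frechet_derivative f (at x) b) = frechet_derivative f (at x) (X x)"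
    if "x \<in> S" for x
    by (rule frechet_derivative_Basis_expansion[OF smooth_onD(1)[OF assms(2) that], symmetric])
qed

text \<open>Here \<open>X\<close> is a vector field, so the point and the direction vary together.\<close>

lemma has_derivative_frechet_derivative:
  fixes f :: "'a::euclidean_space \<Rightarrow> 'b::real_normed_vector"
  assumes S: "open S" "p \<in> S" and f: "smooth_on f S" and X: "(X has_derivative X') (at p)"
  shows "((\<lambda>q. frechet_derivative f (at q) (X q)) has_derivative
    (\<lambda>w. frechet_derivative (\<lambda>q. frechet_derivative f (at q) (X p)) (at p) w
       + frechet_derivative f (at p) (X' w))) (at p)"
proof -
  note expand = frechet_derivative_Basis_expansion[OF smooth_onD(1)[OF f]]
  note hd = frechet_derivative_has_derivative[OF smooth_onD(1)[OF smooth_onD(2)[OF f] S(2)]]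
  \<comment> \<open>The second derivative is linear in the inner direction as well; this folds the
    basis expansion back together at the end.\<close>
  have fixed: "frechet_derivative (\<lambda>q. frechet_derivative f (at q) v) (at p) w =
      (\<Sum>b\<in>Basis. (v \<bullet> b) *\<^sub>R frechet_derivative (\<lambda>q. frechet_derivative f (at q) b) (at p) w)" for v w
  proof (rule frechet_derivative_eqI)
    have "((\<lambda>q. \<Sum>b\<in>Basis. (v \<bullet> b) *\<^sub>R frechet_derivative f (at q) b) has_derivative
      (\<lambda>w. \<Sum>b\<in>Basis. (v \<bullet> b) *\<^sub>R frechet_derivative (\<lambda>q. frechet_derivative f (at q) b) (at p) w)) (at p)"
      by (intro has_derivative_sum has_derivative_scaleR_right hd)
    from this S show "((\<lambda>q. frechet_derivative f (at q) v) has_derivative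
      (\<lambda>w. \<Sum>b\<in>Basis. (v \<bullet> b) *\<^sub>R frechet_derivative (\<lambda>q. frechet_derivative f (at q) b) (at p) w)) (at p)"
      by (rule has_derivative_transform_within_open) (rule expand[symmetric])
  qed
  have "((\<lambda>q. \<Sum>b\<in>Basis. (X q \<bullet> b) *\<^sub>R frechet_derivative f (at q) b) has_derivative
      (\<lambda>w. \<Sum>b\<in>Basis. (X p \<bullet> b) *\<^sub>R frechet_derivative (\<lambda>q. frechet_derivative f (at q) b) (at p) w
         + (X' w \<bullet> b) *\<^sub>R frechet_derivative f (at p) b)) (at p)"
    by (intro has_derivative_sum has_derivative_scaleR has_derivative_inner_left hd X)
  from this S
  have "((\<lambda>q. frechet_derivative f (at q) (X q)) has_derivative
      (\<lambda>w. \<Sum>b\<in>Basis. (X p \<bullet> b) *\<^sub>R frechet_derivative (\<lambda>q. frechet_derivative f (at q) b) (at p) w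
         + (X' w \<bullet> b) *\<^sub>R frechet_derivative f (at p) b)) (at p)"
    by (rule has_derivative_transform_within_open) (rule expand[symmetric])
  moreover have "(\<Sum>b\<in>Basis. (X p \<bullet> b) *\<^sub>R frechet_derivative (\<lambda>q. frechet_derivative f (at q) b) (at p) w
         + (X' w \<bullet> b) *\<^sub>R frechet_derivative f (at p) b) =
      frechet_derivative (\<lambda>q. frechet_derivative f (at q) (X p)) (at p) w
       + frechet_derivative f (at p) (X' w)" for w
    by (simp only: sum.distrib fixed[of "X p"] expand[OF S(2), where v = "X' w"])
  ultimately show ?thesis by simp
qed

section \<open>First-order expansion with quadratic remainder\<close>

lemma differentiable_imp_locally_lipschitz_at:
  fixes f :: "'a::real_normed_vector \<Rightarrow> 'b::real_normed_vector"
  assumes "f differentiable (at a)"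
  obtains K where "K \<ge> 0" "\<forall>\<^sub>F x in nhds a. norm (f x - f a) \<le> K * norm (x - a)"
proof -
  from assms have f: "bounded_linear (frechet_derivative f (at a))"
    "\<And>e. e > 0 \<Longrightarrow> \<exists>d>0. \<forall>y. norm (y - a) < d \<longrightarrow>
      norm (f y - f a - frechet_derivative f (at a) (y - a)) \<le> e * norm (y - a)"
    using frechet_derivative_has_derivative[OF assms] unfolding has_derivative_at_alt by blast+
  from bounded_linear.pos_bounded[OF f(1)] obtain B where B: "B > 0"
    "\<And>v. norm (frechet_derivative f (at a) v) \<le> norm v * B" by blast
  from f(2)[of 1] obtain d where d: "d > 0" "\<And>y. norm (y - a) < d \<Longrightarrow>
      norm (f y - f a - frechet_derivative f (at a) (y - a)) \<le> norm (y - a)" by auto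
  show ?thesis
  \<comment> \<open>The operator bound \<open>B\<close>, plus 1 for the relative error of the linear
    approximation.\<close>
  proof (rule that[of "B + 1"])
    show "\<forall>\<^sub>F x in nhds a. norm (f x - f a) \<le> (B + 1) * norm (x - a)"
      unfolding eventually_nhds_metric
    proof (intro exI conjI allI impI)
      fix y assume "dist y a < d"
      then have "norm (f y - f a - frechet_derivative f (at a) (y - a)) \<le> norm (y - a)"
        using d(2) by (simp add: dist_norm)
      then show "norm (f y - f a) \<le> (B + 1) * norm (y - a)"
        using B(2)[of "y - a"] norm_triangle_sub[of "f y - f a" "frechet_derivative f (at a) (y - a)"]
        by (simp add: algebra_simps)
    qed (rule d)
  qed (use B in simp)
qed

text \<open>The mean value inequality for \<open>f\<close> minus its linear part on the ball of
  radius \<open>norm g\<close>. The derivative of this difference is at most a constant times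
  \<open>norm g\<close> there, since the first partial derivatives are themselves differentiable at
  0.\<close>

lemma smooth_on_linear_approximation:
  fixes f :: "'a::euclidean_space \<Rightarrow> real"
  assumes S: "open S" "0 \<in> S" and f: "smooth_on f S"
  shows "(\<lambda>x. f x - f 0 - frechet_derivative f (at 0) x) \<in> O[nhds 0](\<lambda>x. (norm x)\<^sup>2)"
proof -
  have "\<exists>K. K \<ge> 0 \<and> (\<forall>\<^sub>F x in nhds 0.
      norm (frechet_derivative f (at x) b - frechet_derivative f (at 0) b) \<le> K * norm x)" for b
    by (rule differentiable_imp_locally_lipschitz_at[OF smooth_onD(1)[OF smooth_onD(2)[OF f, of b] S(2)]]) auto
  then have "\<forall>b. \<exists>K. K \<ge> 0 \<and> (\<forall>\<^sub>F x in nhds 0.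
      norm (frechet_derivative f (at x) b - frechet_derivative f (at 0) b) \<le> K * norm x)" by blast
  from choice[OF this] obtain K where K: "\<And>b. K b \<ge> 0"
    "\<And>b. \<forall>\<^sub>F x in nhds 0. norm (frechet_derivative f (at x) b - frechet_derivative f (at 0) b) \<le> K b * norm x"
    by blast
  define C where "C = (\<Sum>b\<in>Basis. K b)"
  have "\<forall>\<^sub>F x in nhds 0. x \<in> S \<and> (\<forall>b\<in>Basis. norm (frechet_derivative f (at x) b - frechet_derivative f (at 0) b) \<le> K b * norm x)"
    by (intro eventually_conj eventually_nhds_in_open S) (use K(2) in \<open>simp add: eventually_ball_finite\<close>)
  then obtain d where d: "d > 0" "\<And>x. norm x < d \<Longrightarrow> x \<in> S"
    "\<And>x b. norm x < d \<Longrightarrow> b \<in> Basis \<Longrightarrow>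
      norm (frechet_derivative f (at x) b - frechet_derivative f (at 0) b) \<le> K b * norm x"
    unfolding eventually_nhds_metric by (auto simp: dist_norm)
  have "norm (f g - f 0 - frechet_derivative f (at 0) g) \<le> C * (norm g)\<^sup>2" if g: "norm g < d" for g
  proof -
    let ?h = "\<lambda>x. f x - frechet_derivative f (at 0) x"
    let ?h' = "\<lambda>x v. frechet_derivative f (at x) v - frechet_derivative f (at 0) v"
    have bl: "bounded_linear (frechet_derivative f (at 0))"
      using frechet_derivative_has_derivative[OF smooth_onD(1)[OF f S(2)]] has_derivative_bounded_linear by blast
    have "norm (?h g - ?h 0) \<le> (C * norm g) * norm (g - 0)"
    proof (rule differentiable_bound[of "cball 0 (norm g)" ?h ?h'])
      fix x :: 'a assume "x \<in> cball 0 (norm g)"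
      then have x: "norm x \<le> norm g" "norm x < d" using g by auto
      note fx = smooth_onD(1)[OF f d(2)[OF x(2)]]
      show "(?h has_derivative ?h' x) (at x within cball 0 (norm g))"
        by (rule has_derivative_at_withinI[OF has_derivative_diff[OF
                frechet_derivative_has_derivative[OF fx] bounded_linear_imp_has_derivative[OF bl]]])
      show "onorm (?h' x) \<le> C * norm g"
      proof (rule onorm_le)
        fix v
        have "?h' x v = (\<Sum>b\<in>Basis. (v \<bullet> b) *\<^sub>R ?h' x b)"
          by (simp only: scaleR_diff_right sum_subtractf
              frechet_derivative_Basis_expansion[OF fx, where v = v]
              frechet_derivative_Basis_expansion[OF smooth_onD(1)[OF f S(2)], where v = v])
        also have "norm \<dots> \<le> (\<Sum>b\<in>Basis. norm v * (K b * norm g))"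
        proof (intro sum_norm_le)
          fix b :: 'a assume b: "b \<in> Basis"
          have "norm (?h' x b) \<le> K b * norm g"
            using d(3)[OF x(2) b] mult_left_mono[OF x(1) K(1)[of b]] by linarith
          then show "norm ((v \<bullet> b) *\<^sub>R ?h' x b) \<le> norm v * (K b * norm g)"
            using Basis_le_norm[OF b, of v] by (simp add: abs_mult mult_mono)
        qed
        also have "\<dots> = C * norm g * norm v"
          by (simp add: C_def sum_distrib_left sum_distrib_right mult_ac)
        finally show "norm (?h' x v) \<le> C * norm g * norm v" .
      qed
    qed auto
    then show ?thesis
      using linear_0[OF bounded_linear.linear[OF bl]] by (simp add: power2_eq_square algebra_simps)
  qed
  then have "\<forall>\<^sub>F g in nhds 0. norm (f g - f 0 - frechet_derivative f (at 0) g) \<le> C * norm ((norm g)\<^sup>2)"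
    unfolding eventually_nhds_metric using d(1) by (auto simp: dist_norm intro!: exI[of _ d])
  then show ?thesis by (rule bigoI)
qed

text \<open>On the ray through the \<open>l\<close>-th axis the bound reads
  \<open>\<bar>c $ l\<bar> * t \<le> K * t\<^sup>2\<close>; divide by \<open>t\<close> and let it
  tend to 0. This makes the Yamaguti constants unique.\<close>

lemma linear_form_bigo_norm_square_imp_zero:
  fixes c :: "real ^ 'n"
  assumes "(\<lambda>g. \<Sum>l\<in>UNIV. c $ l * g $ l) \<in> O[nhds 0](\<lambda>g. (norm g)\<^sup>2)"
  shows "c = 0"
proof (subst vec_eq_iff, rule allI)
  fix l
  from assms obtain K where K: "K > 0"
    "\<forall>\<^sub>F g in nhds 0. norm (\<Sum>l\<in>UNIV. c $ l * g $ l) \<le> K * norm ((norm g)\<^sup>2)"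
    by (elim landau_o.bigE)
  have "((\<lambda>t::real. t *\<^sub>R axis l 1 :: real ^ 'n) \<longlongrightarrow> 0 *\<^sub>R axis l 1) (at_right 0)"
    by (intro tendsto_intros)
  then have lim: "((\<lambda>t::real. t *\<^sub>R axis l 1 :: real ^ 'n) \<longlongrightarrow> 0) (at_right 0)" by simp
  have "\<forall>\<^sub>F t in at_right 0. norm (\<Sum>j\<in>UNIV. c $ j * (t *\<^sub>R axis l 1 :: real ^ 'n) $ j)
      \<le> K * norm ((norm (t *\<^sub>R axis l 1 :: real ^ 'n))\<^sup>2)"
    by (rule eventually_compose_filterlim[OF K(2) lim])
  moreover have "(\<Sum>j\<in>UNIV. c $ j * (t *\<^sub>R axis l 1 :: real ^ 'n) $ j) = c $ l * t" for t
    by (simp add: axis_def if_distrib cong: if_cong)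
  ultimately have "\<forall>\<^sub>F t in at_right 0. \<bar>c $ l\<bar> * \<bar>t\<bar> \<le> K * t\<^sup>2"
    by (simp add: abs_mult norm_axis_1)
  moreover have "\<forall>\<^sub>F t::real in at_right 0. t > 0" by (rule eventually_at_right_less)
  ultimately have "\<forall>\<^sub>F t in at_right 0. \<bar>c $ l\<bar> \<le> K * t"
    by eventually_elim (simp add: power2_eq_square flip: mult.assoc)
  moreover have "((\<lambda>t. K * t) \<longlongrightarrow> K * 0) (at_right 0)" by (intro tendsto_intros)
  ultimately have "\<bar>c $ l\<bar> \<le> K * 0"
    by (intro tendsto_le[OF trivial_limit_at_right_real _ tendsto_const])
  then show "c $ l = 0 $ l" by simp
qed

section \<open>Lie brackets via Frechet derivatives\<close>

lemma partial_eq_frechet_derivative: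
  assumes "f differentiable (at g)"
  shows "partial p f g = frechet_derivative f (at g) (axis p 1)"
proof -
  interpret linear "frechet_derivative f (at g)" using linear_frechet_derivative[OF assms] .
  have "((\<lambda>t::real. g + t *\<^sub>R axis p 1) has_derivative (\<lambda>t. t *\<^sub>R axis p 1)) (at 0)"
    by (auto intro!: derivative_eq_intros)
  from has_derivative_compose[OF this, of f "frechet_derivative f (at g)"]
  have "((\<lambda>t. f (g + t *\<^sub>R axis p 1)) has_derivative (\<lambda>t. frechet_derivative f (at g) (t *\<^sub>R axis p 1))) (at 0)"
    using frechet_derivative_has_derivative[OF assms] by simp
  then have "((\<lambda>t. f (g + t *\<^sub>R axis p 1)) has_field_derivative frechet_derivative f (at g) (axis p 1)) (at 0)"
    by (simp add: has_field_derivative_def scaleR mult_commute_abs)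
  then show ?thesis unfolding partial_def by (rule DERIV_imp_deriv)
qed

lemma frechet_derivative_vec_nth:
  assumes "f differentiable (at g)"
  shows "(\<lambda>x. f x $ s) differentiable (at g)"
    and "frechet_derivative (\<lambda>x. f x $ s) (at g) v = frechet_derivative f (at g) v $ s"
proof -
  have "((\<lambda>x. f x $ s) has_derivative (\<lambda>v. frechet_derivative f (at g) v $ s)) (at g)"
    by (rule bounded_linear.has_derivative[OF bounded_linear_vec_nth frechet_derivative_has_derivative[OF assms]])
  then show "(\<lambda>x. f x $ s) differentiable (at g)"
    and "frechet_derivative (\<lambda>x. f x $ s) (at g) v = frechet_derivative f (at g) v $ s"
    using frechet_derivative_eqI by (auto simp: differentiable_def)
qed

lemma frechet_derivative_axis_expansion:
  fixes f :: "real ^ 'n \<Rightarrow> 'b::real_normed_vector"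
  assumes "f differentiable (at x)"
  shows "frechet_derivative f (at x) v = (\<Sum>p\<in>UNIV. v $ p *\<^sub>R frechet_derivative f (at x) (axis p 1))"
proof -
  interpret linear "frechet_derivative f (at x)" using linear_frechet_derivative[OF assms] .
  have "v = (\<Sum>p\<in>UNIV. v $ p *\<^sub>R axis p 1)" using basis_expansion[of v] by (simp add: scalar_mult_eq_scaleR)
  then have "frechet_derivative f (at x) v = frechet_derivative f (at x) (\<Sum>p\<in>UNIV. v $ p *\<^sub>R axis p 1)" by simp
  then show ?thesis by (simp add: sum scaleR)
qed

text \<open>From here on brackets are treated in this coordinate-free form; only
  \<open>secondary_eq_lie_bracket\<close> returns to the coordinates.\<close>

lemma lie_bracket_eq_frechet_derivative:
  assumes X: "X differentiable (at g)" and Y: "Y differentiable (at g)"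
  shows "lie_bracket X Y g = frechet_derivative Y (at g) (X g) - frechet_derivative X (at g) (Y g)"
proof (subst vec_eq_iff, rule allI)
  fix s
  have "lie_bracket X Y g $ s = (\<Sum>p\<in>UNIV. X g $ p * frechet_derivative Y (at g) (axis p 1) $ s)
      - (\<Sum>p\<in>UNIV. Y g $ p * frechet_derivative X (at g) (axis p 1) $ s)"
    unfolding lie_bracket_def using X Y
    by (simp add: partial_eq_frechet_derivative frechet_derivative_vec_nth sum_subtractf)
  then show "lie_bracket X Y g $ s =
      (frechet_derivative Y (at g) (X g) - frechet_derivative X (at g) (Y g)) $ s"
    by (simp add: frechet_derivative_axis_expansion[OF X, where v = "Y g"]
        frechet_derivative_axis_expansion[OF Y, where v = "X g"])
qed

lemma smooth_on_lie_bracket: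
  assumes "open S" "smooth_on X S" "smooth_on Y S"
  shows "smooth_on (lie_bracket X Y) S"
  by (rule smooth_on_cong[OF assms(1) smooth_on_diff[OF assms(1)
          smooth_on_frechet_derivative[OF assms(1,3,2)] smooth_on_frechet_derivative[OF assms(1,2,3)]]])
    (simp add: lie_bracket_eq_frechet_derivative smooth_onD(1)[OF assms(2)] smooth_onD(1)[OF assms(3)])

text \<open>With \<open>p\<close> fixed near \<open>y\<close>, the variable \<open>a\<close> still
  runs through a neighbourhood of \<open>x\<close>, so an identity of germs in two variables can be
  differentiated in \<open>a\<close> alone.\<close>

lemma eventually_nhds_curry:
  assumes "\<forall>\<^sub>F (a, p) in nhds (x, y). P a p"
  shows "\<forall>\<^sub>F p in nhds y. \<forall>\<^sub>F a in nhds x. P a p"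
  using assms eventually_eventually_prod_filter2[of "\<lambda>(a, p). P a p" "nhds x" "nhds y"] by (simp add: nhds_prod)

lemma frechet_derivative_minus:
  "f differentiable (at x) \<Longrightarrow> frechet_derivative (\<lambda>x. - f x) (at x) v = - frechet_derivative f (at x) v"
  by (intro frechet_derivative_eqI has_derivative_minus frechet_derivative_has_derivative)

text \<open>This removes the signs from the brackets of the autotopism triples.\<close>

lemma lie_bracket_minus_minus:
  assumes "X differentiable (at g)" "Y differentiable (at g)"
  shows "lie_bracket (\<lambda>g. - X g) (\<lambda>g. - Y g) g = lie_bracket X Y g"
proof -
  interpret X: linear "frechet_derivative X (at g)" using linear_frechet_derivative[OF assms(1)] .
  interpret Y: linear "frechet_derivative Y (at g)" using linear_frechet_derivative[OF assms(2)] .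
  show ?thesis
    by (simp add: lie_bracket_eq_frechet_derivative assms
        frechet_derivative_minus X.neg Y.neg)
qed

section \<open>Translation fields and their brackets in coordinates\<close>

lemma translation_field_axis: "translation_field a (axis j 1) g $ s = a s j g"
  by (simp add: translation_field_def axis_def if_distrib[of "\<lambda>u. u * _"] cong: if_cong)

lemma translation_field_scaleR: "translation_field a (c *\<^sub>R x) g = c *\<^sub>R translation_field a x g"
  by (simp add: translation_field_def vec_eq_iff sum_distrib_left mult.assoc)

lemma translation_field_expansion:
  "translation_field a x g = (\<Sum>j\<in>UNIV. x $ j *\<^sub>R translation_field a (axis j 1) g)"
  by (simp add: vec_eq_iff translation_field_axis) (simp add: translation_field_def)

text \<open>In \<open>secondary\<close> the field with index \<open>k\<close> differentiates the one
  with index \<open>j\<close>, the reverse of the order in \<open>lie_bracket\<close>; hence the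
  sign.\<close>

lemma secondary_eq_lie_bracket:
  "secondary a s j k g = - lie_bracket (translation_field a (axis j 1)) (translation_field a (axis k 1)) g $ s"
  by (simp add: secondary_def lie_bracket_def translation_field_axis sum_negf[symmetric])

text \<open>The coordinates of \<open>x\<close> and \<open>y\<close> do not depend on
  \<open>g\<close>, so the bracket is bilinear in them without derivative terms.\<close>

lemma lie_bracket_translation_field_expansion:
  assumes "\<And>j. translation_field a (axis j 1) differentiable (at g)"
  shows "lie_bracket (translation_field a x) (translation_field a y) g =
    (\<Sum>j\<in>UNIV. \<Sum>k\<in>UNIV. (x $ j * y $ k) *\<^sub>R
      lie_bracket (translation_field a (axis j 1)) (translation_field a (axis k 1)) g)"
proof -
  let ?T = "\<lambda>j. translation_field a (axis j 1)"
  have hd: "(translation_field a x has_derivative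
      (\<lambda>v. \<Sum>j\<in>UNIV. x $ j *\<^sub>R frechet_derivative (?T j) (at g) v)) (at g)" for x
  proof -
    have "((\<lambda>g. \<Sum>j\<in>UNIV. x $ j *\<^sub>R ?T j g) has_derivative
      (\<lambda>v. \<Sum>j\<in>UNIV. x $ j *\<^sub>R frechet_derivative (?T j) (at g) v)) (at g)"
      by (intro has_derivative_sum has_derivative_scaleR_right frechet_derivative_has_derivative assms)
    moreover have "translation_field a x = (\<lambda>g. \<Sum>j\<in>UNIV. x $ j *\<^sub>R ?T j g)"
      by (rule ext) (rule translation_field_expansion)
    ultimately show ?thesis by simp
  qed
  then have diff: "translation_field a x differentiable (at g)" for x
    unfolding differentiable_def by blast
  have *: "frechet_derivative (translation_field a y) (at g) (translation_field a x g) =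
      (\<Sum>j\<in>UNIV. \<Sum>k\<in>UNIV. (x $ j * y $ k) *\<^sub>R frechet_derivative (?T k) (at g) (?T j g))" for x y
  proof -
    have "frechet_derivative (?T k) (at g) (translation_field a x g) =
        (\<Sum>j\<in>UNIV. x $ j *\<^sub>R frechet_derivative (?T k) (at g) (?T j g))" for k
    proof -
      interpret linear "frechet_derivative (?T k) (at g)" using linear_frechet_derivative[OF assms] .
      show ?thesis by (subst translation_field_expansion) (simp only: sum scaleR)
    qed
    then have "frechet_derivative (translation_field a y) (at g) (translation_field a x g) =
      (\<Sum>k\<in>UNIV. \<Sum>j\<in>UNIV. (x $ j * y $ k) *\<^sub>R frechet_derivative (?T k) (at g) (?T j g))"
      by (simp add: frechet_derivative_eqI[OF hd[of y]] scaleR_sum_right mult.commute)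
    then show ?thesis by (subst sum.swap)
  qed
  have "frechet_derivative (translation_field a x) (at g) (translation_field a y g) =
      (\<Sum>j\<in>UNIV. \<Sum>k\<in>UNIV. (x $ j * y $ k) *\<^sub>R frechet_derivative (?T j) (at g) (?T k g))"
    by (subst *[where x = y and y = x], subst sum.swap) (simp add: mult.commute)
  then show ?thesis
    by (simp add: lie_bracket_eq_frechet_derivative diff *[where x = x and y = y] scaleR_diff_right sum_subtractf)
qed

section \<open>Calculus on the loop\<close>

context local_analytic_Moufang_loop
begin

definition m :: "(real ^ 'n) \<times> (real ^ 'n) \<Rightarrow> real ^ 'n" where
  "m p = mul (fst p) (snd p)"

text \<open>Taking the interior gives an open set at once, without an argument that analyticity is
  an open condition.\<close>

definition W :: "((real ^ 'n) \<times> (real ^ 'n)) set" where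
  "W = interior {p. real_analytic_at m p}"

text \<open>Here both slices of the product lie in \<open>W\<close>, so the translation fields are
  values of \<open>Dm\<close> and hence smooth.\<close>

definition N :: "(real ^ 'n) set" where
  "N = {g. (0, g) \<in> W \<and> (g, 0) \<in> W}"

abbreviation Dm :: "(real ^ 'n) \<times> (real ^ 'n) \<Rightarrow> (real ^ 'n) \<times> (real ^ 'n) \<Rightarrow> real ^ 'n" where
  "Dm p \<equiv> frechet_derivative m (at p)"

abbreviation L :: "real ^ 'n \<Rightarrow> real ^ 'n \<Rightarrow> real ^ 'n" where "L \<equiv> transl_L mul"
abbreviation R :: "real ^ 'n \<Rightarrow> real ^ 'n \<Rightarrow> real ^ 'n" where "R \<equiv> transl_R mul"
abbreviation M :: "real ^ 'n \<Rightarrow> real ^ 'n \<Rightarrow> real ^ 'n" where "M \<equiv> transl_M mul"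

lemma open_W: "open W" by (simp add: W_def)

lemma zero_in_W: "(0, 0) \<in> W"
proof -
  have "\<forall>\<^sub>F p in nhds (0, 0). real_analytic_at m p"
  proof -
    have "m = (\<lambda>(g, h). mul g h)" by (auto simp: m_def)
    then show ?thesis using mul_analytic by simp
  qed
  then show ?thesis unfolding W_def eventually_nhds interior_def by blast
qed

lemma open_N: "open N"
proof -
  have "N = (\<lambda>g. (0, g)) -` W \<inter> (\<lambda>g. (g, 0)) -` W" by (auto simp: N_def)
  then show ?thesis by (auto intro!: open_Int open_vimage open_W continuous_intros)
qed

lemma zero_in_N: "0 \<in> N" using zero_in_W by (simp add: N_def)

lemma analytic_m: "p \<in> W \<Longrightarrow> real_analytic_at m p"
  using interior_subset W_def by auto

lemma smooth_m: "smooth_on m W"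
  unfolding smooth_on_def using real_analytic_times_differentiable_on analytic_m by blast

lemma has_derivative_m: "p \<in> W \<Longrightarrow> (m has_derivative Dm p) (at p)"
  using smooth_onD(1)[OF smooth_m] frechet_derivative_has_derivative by blast

lemma linear_Dm: "p \<in> W \<Longrightarrow> linear (Dm p)"
  using has_derivative_m has_derivative_linear by blast

lemma Dm_Pair: "p \<in> W \<Longrightarrow> Dm p (u, v) = Dm p (u, 0) + Dm p (0, v)"
  using linear_add[OF linear_Dm, of p "(u, 0)" "(0, v)"] by simp

lemma has_derivative_mul:
  assumes "(f g, h g) \<in> W" "(f has_derivative f') (at g)" "(h has_derivative h') (at g)"
  shows "((\<lambda>x. mul (f x) (h x)) has_derivative (\<lambda>v. Dm (f g, h g) (f' v, h' v))) (at g)"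
  using has_derivative_compose[OF has_derivative_Pair[OF assms(2,3)] has_derivative_m[OF assms(1)]]
  by (simp add: m_def)

lemma aux_u_eq: "g \<in> N \<Longrightarrow> aux_u mul i j g = Dm (0, g) (axis j 1, 0) $ i"
  and aux_v_eq: "g \<in> N \<Longrightarrow> aux_v mul i j g = Dm (g, 0) (0, axis j 1) $ i"
proof -
  assume g: "g \<in> N"
  have 1: "((\<lambda>h. mul h g) has_derivative (\<lambda>v. Dm (0, g) (v, 0))) (at 0)"
    and 2: "((\<lambda>h. mul g h) has_derivative (\<lambda>v. Dm (g, 0) (0, v))) (at 0)"
    using has_derivative_mul[of "\<lambda>h. h" 0 "\<lambda>h. g", OF _ has_derivative_ident has_derivative_const]
      has_derivative_mul[of "\<lambda>h. g" 0 "\<lambda>h. h", OF _ has_derivative_const has_derivative_ident] g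
    by (auto simp: N_def)
  have "(\<lambda>h. mul h g) differentiable (at 0)" "(\<lambda>h. mul g h) differentiable (at 0)"
    using 1 2 by (auto simp: differentiable_def)
  then show "aux_u mul i j g = Dm (0, g) (axis j 1, 0) $ i" "aux_v mul i j g = Dm (g, 0) (0, axis j 1) $ i"
    unfolding aux_u_def aux_v_def
    by (simp_all add: partial_eq_frechet_derivative frechet_derivative_vec_nth
        frechet_derivative_eqI[OF 1] frechet_derivative_eqI[OF 2])
qed

lemma transl_L_eq: assumes "g \<in> N" shows "L x g = Dm (0, g) (x, 0)"
proof -
  interpret linear "Dm (0, g)" using linear_Dm assms by (auto simp: N_def)
  have "(x, 0) = (\<Sum>j\<in>UNIV. x $ j *\<^sub>R (axis j 1 :: real ^ 'n, 0 :: real ^ 'n))"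
    using basis_expansion[of x] by (simp add: scalar_mult_eq_scaleR prod_eq_iff fst_sum snd_sum)
  then have "Dm (0, g) (x, 0) = (\<Sum>j\<in>UNIV. x $ j *\<^sub>R Dm (0, g) (axis j 1, 0))"
    by (simp only: sum scaleR)
  then show ?thesis using assms by (simp add: transl_L_def translation_field_def aux_u_eq vec_eq_iff)
qed

lemma transl_R_eq: assumes "g \<in> N" shows "R x g = Dm (g, 0) (0, x)"
proof -
  interpret linear "Dm (g, 0)" using linear_Dm assms by (auto simp: N_def)
  have "(0, x) = (\<Sum>j\<in>UNIV. x $ j *\<^sub>R (0 :: real ^ 'n, axis j 1 :: real ^ 'n))"
    using basis_expansion[of x] by (simp add: scalar_mult_eq_scaleR prod_eq_iff fst_sum snd_sum)
  then have "Dm (g, 0) (0, x) = (\<Sum>j\<in>UNIV. x $ j *\<^sub>R Dm (g, 0) (0, axis j 1))"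
    by (simp only: sum scaleR)
  then show ?thesis using assms by (simp add: transl_R_def translation_field_def aux_v_eq vec_eq_iff)
qed

lemma transl_M_eq: "M x g = - L x g - R x g"
  by (simp add: transl_M_def transl_L_def transl_R_def translation_field_def aux_w_def vec_eq_iff
      right_diff_distrib sum_subtractf sum_negf)

lemma smooth_L: "smooth_on (L x) N"
proof (rule smooth_on_cong[OF open_N])
  have "times_differentiable_on k (\<lambda>g. Dm (0, g) (x, 0)) N" for k
    by (rule times_differentiable_on_compose_linear[OF open_N, where T = W and i = "\<lambda>g. (0, g)"])
      (use smooth_onD(2)[OF smooth_m] in \<open>auto simp: N_def smooth_on_def intro!: bounded_linear_Pair bounded_linear_zero bounded_linear_ident\<close>)
  then show "smooth_on (\<lambda>g. Dm (0, g) (x, 0)) N" by (simp add: smooth_on_def)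
qed (simp add: transl_L_eq)

lemma smooth_R: "smooth_on (R x) N"
proof (rule smooth_on_cong[OF open_N])
  have "times_differentiable_on k (\<lambda>g. Dm (g, 0) (0, x)) N" for k
    by (rule times_differentiable_on_compose_linear[OF open_N, where T = W and i = "\<lambda>g. (g, 0)"])
      (use smooth_onD(2)[OF smooth_m] in \<open>auto simp: N_def smooth_on_def intro!: bounded_linear_Pair bounded_linear_zero bounded_linear_ident\<close>)
  then show "smooth_on (\<lambda>g. Dm (g, 0) (0, x)) N" by (simp add: smooth_on_def)
qed (simp add: transl_R_eq)

lemma smooth_M: "smooth_on (M x) N"
  by (rule smooth_on_cong[OF open_N smooth_on_diff[OF open_N smooth_on_minus[OF open_N smooth_L] smooth_R]])
    (simp add: transl_M_eq)

section \<open>Loop identities along a filter at the unit\<close>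

lemma m_zero: "m (0, 0) = 0"
  using eventually_nhds_x_imp_x[OF unit] by (simp add: m_def)

text \<open>Continuity at the unit keeps words in small elements small; this is what allows one
  eventual identity to be substituted into another.\<close>

lemma tendsto_mul:
  assumes "(f \<longlongrightarrow> 0) F" "(g \<longlongrightarrow> 0) F"
  shows "((\<lambda>x. mul (f x) (g x)) \<longlongrightarrow> 0) F"
proof -
  have "isCont m (0, 0)" using has_derivative_continuous[OF has_derivative_m[OF zero_in_W]] .
  from isCont_tendsto_compose[OF this tendsto_Pair[OF assms]] show ?thesis by (simp add: m_zero) (simp add: m_def)
qed

lemma iv_differentiable: "iv differentiable (at 0)"
  using eventually_nhds_x_imp_x[OF iv_analytic] by (rule real_analytic_at_imp_differentiable)

lemma tendsto_iv: assumes "(f \<longlongrightarrow> 0) F" shows "((\<lambda>x. iv (f x)) \<longlongrightarrow> 0) F"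
  using isCont_tendsto_compose[OF differentiable_imp_continuous_within[OF iv_differentiable] assms]
  by (simp add: iv_zero)

lemma eventually_unit:
  assumes "(f \<longlongrightarrow> 0) F"
  shows "\<forall>\<^sub>F x in F. mul 0 (f x) = f x" "\<forall>\<^sub>F x in F. mul (f x) 0 = f x"
  using eventually_compose_filterlim[OF unit assms] by (auto elim: eventually_mono)

lemma eventually_inverse:
  assumes "(f \<longlongrightarrow> 0) F"
  shows "\<forall>\<^sub>F x in F. mul (f x) (iv (f x)) = 0" "\<forall>\<^sub>F x in F. mul (iv (f x)) (f x) = 0"
  using eventually_compose_filterlim[OF inverse assms] by (auto elim: eventually_mono)

lemma eventually_Moufang:
  assumes "(a \<longlongrightarrow> 0) F" "(g \<longlongrightarrow> 0) F" "(h \<longlongrightarrow> 0) F"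
  shows "\<forall>\<^sub>F x in F. mul (mul (a x) (g x)) (mul (h x) (a x)) = mul (a x) (mul (mul (g x) (h x)) (a x))"
  using eventually_compose_filterlim[OF Moufang tendsto_Pair[OF assms(1) tendsto_Pair[OF assms(2,3)]]]
  by simp

text \<open>Eventually both factors lie in \<open>V\<close> and solve the same equation, to which
  \<open>local_quasigroup\<close> allows only one solution there.\<close>

lemma eventually_left_cancel:
  assumes "(a \<longlongrightarrow> 0) F" "(g \<longlongrightarrow> 0) F" "(h \<longlongrightarrow> 0) F"
    and eq: "\<forall>\<^sub>F x in F. mul (a x) (g x) = mul (a x) (h x)"
  shows "\<forall>\<^sub>F x in F. g x = h x"
proof -
  from local_quasigroup obtain U V where UV: "open U" "0 \<in> U" "open V" "0 \<in> V"
    and div: "\<forall>a\<in>U. \<forall>b\<in>U. (\<exists>!x\<in>V. mul a x = b) \<and> (\<exists>!y\<in>V. mul y a = b)" by (elim exE conjE)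
  note ev = topological_tendstoD[OF assms(1) UV(1,2)] topological_tendstoD[OF assms(2) UV(3,4)]
    topological_tendstoD[OF assms(3) UV(3,4)] topological_tendstoD[OF tendsto_mul[OF assms(1,2)] UV(1,2)]
  from ev eq show ?thesis
  proof eventually_elim
    case (elim x)
    from conjunct1[OF bspec[OF bspec[OF div elim(1)] elim(4)]] obtain z where z: "\<And>y. y \<in> V \<Longrightarrow> mul (a x) y = mul (a x) (g x) \<Longrightarrow> y = z"
      by auto
    from z[of "g x"] z[of "h x"] elim show ?case by simp
  qed
qed

lemma eventually_right_cancel:
  assumes "(a \<longlongrightarrow> 0) F" "(g \<longlongrightarrow> 0) F" "(h \<longlongrightarrow> 0) F"
    and eq: "\<forall>\<^sub>F x in F. mul (g x) (a x) = mul (h x) (a x)"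
  shows "\<forall>\<^sub>F x in F. g x = h x"
proof -
  from local_quasigroup obtain U V where UV: "open U" "0 \<in> U" "open V" "0 \<in> V"
    and div: "\<forall>a\<in>U. \<forall>b\<in>U. (\<exists>!x\<in>V. mul a x = b) \<and> (\<exists>!y\<in>V. mul y a = b)" by (elim exE conjE)
  note ev = topological_tendstoD[OF assms(1) UV(1,2)] topological_tendstoD[OF assms(2) UV(3,4)]
    topological_tendstoD[OF assms(3) UV(3,4)] topological_tendstoD[OF tendsto_mul[OF assms(2,1)] UV(1,2)]
  from ev eq show ?thesis
  proof eventually_elim
    case (elim x)
    from conjunct2[OF bspec[OF bspec[OF div elim(1)] elim(4)]] obtain z where z: "\<And>y. y \<in> V \<Longrightarrow> mul y (a x) = mul (g x) (a x) \<Longrightarrow> y = z"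
      by auto
    from z[of "g x"] z[of "h x"] elim show ?case by simp
  qed
qed

subsection \<open>The inverse property and the other Moufang identities\<close>

lemma eventually_iv_iv:
  assumes a: "(a \<longlongrightarrow> 0) F"
  shows "\<forall>\<^sub>F x in F. iv (iv (a x)) = a x"
proof (rule eventually_left_cancel[OF tendsto_iv[OF a] tendsto_iv[OF tendsto_iv[OF a]] a])
  from eventually_inverse(1)[OF tendsto_iv[OF a]] eventually_inverse(2)[OF a]
  show "\<forall>\<^sub>F x in F. mul (iv (a x)) (iv (iv (a x))) = mul (iv (a x)) (a x)"
    by eventually_elim simp
qed

text \<open>Put \<open>h = a\<inverse>\<close> in the Moufang identity:
  \<open>ag = a((ga\<inverse>)a)\<close>, and cancel \<open>a\<close>. The second form replaces
  \<open>a\<close> by its inverse.\<close>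

lemma eventually_right_inverse_property:
  assumes a: "(a \<longlongrightarrow> 0) F" and g: "(g \<longlongrightarrow> 0) F"
  shows "\<forall>\<^sub>F x in F. mul (mul (g x) (iv (a x))) (a x) = g x"
    and "\<forall>\<^sub>F x in F. mul (mul (g x) (a x)) (iv (a x)) = g x"
proof -
  have *: "\<forall>\<^sub>F x in F. mul (mul (g x) (iv (a x))) (a x) = g x" if a: "(a \<longlongrightarrow> 0) F" for a
  proof (rule eventually_left_cancel[OF a _ g])
    show "((\<lambda>x. mul (mul (g x) (iv (a x))) (a x)) \<longlongrightarrow> 0) F" by (intro tendsto_mul tendsto_iv a g)
    from eventually_Moufang[OF a g tendsto_iv[OF a]] eventually_inverse(2)[OF a]
      eventually_unit(2)[OF tendsto_mul[OF a g]]
    show "\<forall>\<^sub>F x in F. mul (a x) (mul (mul (g x) (iv (a x))) (a x)) = mul (a x) (g x)"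
      by eventually_elim simp
  qed
  show "\<forall>\<^sub>F x in F. mul (mul (g x) (iv (a x))) (a x) = g x" using *[OF a] .
  from *[OF tendsto_iv[OF a]] eventually_iv_iv[OF a]
  show "\<forall>\<^sub>F x in F. mul (mul (g x) (a x)) (iv (a x)) = g x" by eventually_elim simp
qed

text \<open>The Moufang identity with first middle factor \<open>a\<inverse>\<close> gives
  \<open>ga = a((a\<inverse>g)a)\<close>, and with \<open>h = e\<close> it gives flexibility, so the
  right side is \<open>(a(a\<inverse>g))a\<close>; cancel \<open>a\<close> on the right.\<close>

lemma eventually_left_inverse_property:
  assumes a: "(a \<longlongrightarrow> 0) F" and g: "(g \<longlongrightarrow> 0) F"
  shows "\<forall>\<^sub>F x in F. mul (iv (a x)) (mul (a x) (g x)) = g x"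
proof -
  have *: "\<forall>\<^sub>F x in F. mul (a x) (mul (iv (a x)) (g x)) = g x" if a: "(a \<longlongrightarrow> 0) F" for a
  proof (rule eventually_right_cancel[OF a _ g])
    show ag: "((\<lambda>x. mul (a x) (mul (iv (a x)) (g x))) \<longlongrightarrow> 0) F" by (intro tendsto_mul tendsto_iv a g)
    have iag: "((\<lambda>x. mul (iv (a x)) (g x)) \<longlongrightarrow> 0) F" by (intro tendsto_mul tendsto_iv a g)
    from eventually_Moufang[OF a tendsto_iv[OF a] g] eventually_inverse(1)[OF a]
      eventually_unit(1)[OF tendsto_mul[OF g a]] eventually_Moufang[OF a iag tendsto_const]
      eventually_unit(1)[OF a] eventually_unit(2)[OF iag]
    show "\<forall>\<^sub>F x in F. mul (mul (a x) (mul (iv (a x)) (g x))) (a x) = mul (g x) (a x)"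
      by eventually_elim simp
  qed
  from *[OF tendsto_iv[OF a]] eventually_iv_iv[OF a]
  show "\<forall>\<^sub>F x in F. mul (iv (a x)) (mul (a x) (g x)) = g x" by eventually_elim simp
qed

text \<open>With \<open>p = ag\<close>: \<open>pg\<inverse> = a\<close>, so
  \<open>p\<inverse>a = g\<inverse>\<close> by the left inverse property, and multiplying by
  \<open>a\<inverse>\<close> on the right isolates \<open>p\<inverse>\<close>.\<close>

lemma eventually_iv_mul:
  assumes a: "(a \<longlongrightarrow> 0) F" and g: "(g \<longlongrightarrow> 0) F"
  shows "\<forall>\<^sub>F x in F. iv (mul (a x) (g x)) = mul (iv (g x)) (iv (a x))"
proof -
  note ag = tendsto_mul[OF a g]
  from eventually_right_inverse_property(2)[OF g a]
    eventually_left_inverse_property[OF ag tendsto_iv[OF g]]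
    eventually_right_inverse_property(2)[OF a tendsto_iv[OF ag]]
  show ?thesis by eventually_elim simp
qed

text \<open>The Moufang identity for \<open>gh\<close> and \<open>h\<inverse>\<close> reads
  \<open>(a(gh))(h\<inverse>a) = a(ga)\<close>; multiply on the right by the inverse
  \<open>a\<inverse>h\<close> of \<open>h\<inverse>a\<close>.\<close>

lemma eventually_left_Moufang:
  assumes a: "(a \<longlongrightarrow> 0) F" and g: "(g \<longlongrightarrow> 0) F" and h: "(h \<longlongrightarrow> 0) F"
  shows "\<forall>\<^sub>F x in F. mul (mul (a x) (mul (g x) (a x))) (mul (iv (a x)) (h x)) = mul (a x) (mul (g x) (h x))"
proof -
  note gh = tendsto_mul[OF g h]
  note ih = tendsto_iv[OF h]
  from eventually_Moufang[OF a gh ih] eventually_right_inverse_property(2)[OF h g]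
    eventually_iv_mul[OF ih a] eventually_iv_iv[OF h]
    eventually_right_inverse_property(2)[OF tendsto_mul[OF ih a] tendsto_mul[OF a gh]]
  show ?thesis by eventually_elim simp
qed

text \<open>The mirror image: \<open>(ag\<inverse>)((gh)a) = a(ha)\<close>, multiplied on the left
  by \<open>ga\<inverse>\<close>.\<close>

lemma eventually_right_Moufang:
  assumes a: "(a \<longlongrightarrow> 0) F" and g: "(g \<longlongrightarrow> 0) F" and h: "(h \<longlongrightarrow> 0) F"
  shows "\<forall>\<^sub>F x in F. mul (mul (g x) (iv (a x))) (mul (a x) (mul (h x) (a x))) = mul (mul (g x) (h x)) (a x)"
proof -
  note gh = tendsto_mul[OF g h]
  note ig = tendsto_iv[OF g]
  from eventually_Moufang[OF a ig gh] eventually_left_inverse_property[OF g h]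
    eventually_iv_mul[OF a ig] eventually_iv_iv[OF g]
    eventually_left_inverse_property[OF tendsto_mul[OF a ig] tendsto_mul[OF gh a]]
  show ?thesis by eventually_elim simp
qed

subsection \<open>Infinitesimal autotopisms\<close>

definition autotopism ::
  "(real ^ 'n \<Rightarrow> real ^ 'n) \<Rightarrow> (real ^ 'n \<Rightarrow> real ^ 'n) \<Rightarrow> (real ^ 'n \<Rightarrow> real ^ 'n) \<Rightarrow> bool" where
  "autotopism A B C \<longleftrightarrow> (\<forall>\<^sub>F p in nhds (0, 0). Dm p (A (fst p), B (snd p)) = C (m p))"

lemma tendsto_fst_snd:
  "((fst :: (real^'n) \<times> (real^'n) \<Rightarrow> _) \<longlongrightarrow> 0) (nhds (0, 0))"
  "((snd :: (real^'n) \<times> (real^'n) \<Rightarrow> _) \<longlongrightarrow> 0) (nhds (0, 0))"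
proof -
  have "filterlim (\<lambda>p::(real^'n) \<times> (real^'n). p) (nhds (0, 0)) (nhds (0, 0))" by (rule filterlim_ident)
  from tendsto_fst[OF this] tendsto_snd[OF this] 
  show "((fst :: (real^'n) \<times> (real^'n) \<Rightarrow> _) \<longlongrightarrow> 0) (nhds (0, 0))"
    "((snd :: (real^'n) \<times> (real^'n) \<Rightarrow> _) \<longlongrightarrow> 0) (nhds (0, 0))" by simp_all
qed

lemma tendsto_m: "(m \<longlongrightarrow> 0) (nhds (0, 0))"
  using tendsto_mul[OF tendsto_fst_snd] by (simp add: m_def[abs_def])

lemma eventually_in_domains:
  "\<forall>\<^sub>F p in nhds (0, 0). p \<in> W \<and> fst p \<in> N \<and> snd p \<in> N \<and> m p \<in> N"
  by (intro eventually_conj topological_tendstoD[OF tendsto_m open_N zero_in_N]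
      topological_tendstoD[OF tendsto_fst_snd(1) open_N zero_in_N]
      topological_tendstoD[OF tendsto_fst_snd(2) open_N zero_in_N]
      eventually_nhds_in_open open_W zero_in_W)

text \<open>The vector fields \<open>(A, B)\<close> on the square of the loop and \<open>C\<close> on the loop are related by the
  product map, and brackets of related fields are related.\<close>

lemma autotopism_lie_bracket:
  assumes smooth: "smooth_on A N" "smooth_on B N" "smooth_on C N"
    "smooth_on A' N" "smooth_on B' N" "smooth_on C' N"
    and aut: "autotopism A B C" "autotopism A' B' C'"
  shows "autotopism (lie_bracket A A') (lie_bracket B B') (lie_bracket C C')"
proof -
  have "\<forall>\<^sub>F p in nhds (0, 0). Dm p (A (fst p), B (snd p)) = C (m p) \<and>
      Dm p (A' (fst p), B' (snd p)) = C' (m p) \<and> p \<in> W \<and> fst p \<in> N \<and> snd p \<in> N \<and> m p \<in> N"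
    using aut eventually_in_domains unfolding autotopism_def by eventually_elim auto
  then obtain U where U: "open U" "(0, 0) \<in> U" and
    PU: "\<And>p. p \<in> U \<Longrightarrow> Dm p (A (fst p), B (snd p)) = C (m p) \<and>
      Dm p (A' (fst p), B' (snd p)) = C' (m p) \<and> p \<in> W \<and> fst p \<in> N \<and> snd p \<in> N \<and> m p \<in> N"
    unfolding eventually_nhds by blast
  have "Dm p (lie_bracket A A' (fst p), lie_bracket B B' (snd p)) = lie_bracket C C' (m p)"
    if p: "p \<in> U" for p
  proof -
    note P = PU[OF p]
    \<comment> \<open>The relation between the fields, differentiated at \<open>p\<close> in the
      direction \<open>w\<close>: a second derivative of \<open>m\<close>, plus \<open>Dm\<close>
      applied to the derivatives of the fields.\<close>
    have key: "frechet_derivative (\<lambda>q. Dm q (A (fst p), B (snd p))) (at p) w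
        + Dm p (frechet_derivative A (at (fst p)) (fst w), frechet_derivative B (at (snd p)) (snd w))
        = frechet_derivative C (at (m p)) (Dm p w)"
      if smooth: "smooth_on A N" "smooth_on B N" "smooth_on C N"
        and aut: "\<And>p. p \<in> U \<Longrightarrow> Dm p (A (fst p), B (snd p)) = C (m p)" for A B C w
    proof -
      have "((\<lambda>q. (A (fst q), B (snd q))) has_derivative (\<lambda>w. (frechet_derivative A (at (fst p)) (fst w),
          frechet_derivative B (at (snd p)) (snd w)))) (at p)"
        using P by (intro has_derivative_Pair has_derivative_compose[OF has_derivative_fst[OF has_derivative_ident]]
            has_derivative_compose[OF has_derivative_snd[OF has_derivative_ident]]
            frechet_derivative_has_derivative smooth_onD(1)[OF smooth(1)] smooth_onD(1)[OF smooth(2)]) auto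
      from has_derivative_frechet_derivative[OF open_W _ smooth_m this] P
      have 1: "((\<lambda>q. Dm q (A (fst q), B (snd q))) has_derivative
        (\<lambda>w. frechet_derivative (\<lambda>q. Dm q (A (fst p), B (snd p))) (at p) w
        + Dm p (frechet_derivative A (at (fst p)) (fst w), frechet_derivative B (at (snd p)) (snd w)))) (at p)"
        by blast
      have "((\<lambda>q. C (m q)) has_derivative (\<lambda>w. frechet_derivative C (at (m p)) (Dm p w))) (at p)"
        using P by (intro has_derivative_compose[OF has_derivative_m] frechet_derivative_has_derivative
            smooth_onD(1)[OF smooth(3)]) auto
      from has_derivative_transform_within_open[OF this U(1) p, of "\<lambda>q. Dm q (A (fst q), B (snd q))"]
      have "((\<lambda>q. Dm q (A (fst q), B (snd q))) has_derivative
          (\<lambda>w. frechet_derivative C (at (m p)) (Dm p w))) (at p)" using aut by simp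
      from fun_cong[OF has_derivative_unique[OF 1 this]] show ?thesis by simp
    qed
    \<comment> \<open>Each relation is now differentiated along the other pair of fields; in the
      difference the second derivatives of \<open>m\<close> cancel by symmetry.\<close>
    let ?X = "(A (fst p), B (snd p))" and ?X' = "(A' (fst p), B' (snd p))"
    have k1: "frechet_derivative (\<lambda>q. Dm q ?X) (at p) ?X'
        + Dm p (frechet_derivative A (at (fst p)) (A' (fst p)), frechet_derivative B (at (snd p)) (B' (snd p)))
        = frechet_derivative C (at (m p)) (Dm p ?X')"
      using key[OF smooth(1-3), of ?X'] PU by simp
    have k2: "frechet_derivative (\<lambda>q. Dm q ?X') (at p) ?X
        + Dm p (frechet_derivative A' (at (fst p)) (A (fst p)), frechet_derivative B' (at (snd p)) (B (snd p)))
        = frechet_derivative C' (at (m p)) (Dm p ?X)"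
      using key[OF smooth(4-6), of ?X] PU by simp
    have sym: "frechet_derivative (\<lambda>q. Dm q ?X) (at p) ?X' = frechet_derivative (\<lambda>q. Dm q ?X') (at p) ?X"
      using P by (intro real_analytic_at_second_derivative_symmetric analytic_m) auto
    interpret linear "Dm p" using linear_Dm P by blast
    have "lie_bracket C C' (m p) = frechet_derivative C' (at (m p)) (Dm p ?X) - frechet_derivative C (at (m p)) (Dm p ?X')"
      using P smooth_onD(1)[OF smooth(3)] smooth_onD(1)[OF smooth(6)] by (simp add: lie_bracket_eq_frechet_derivative)
    also have "\<dots> = Dm p (frechet_derivative A' (at (fst p)) (A (fst p)), frechet_derivative B' (at (snd p)) (B (snd p)))
       - Dm p (frechet_derivative A (at (fst p)) (A' (fst p)), frechet_derivative B (at (snd p)) (B' (snd p)))"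
      unfolding k1[symmetric] k2[symmetric] sym by simp
    also have "\<dots> = Dm p (lie_bracket A A' (fst p), lie_bracket B B' (snd p))"
      using P smooth_onD(1)[OF smooth(1)] smooth_onD(1)[OF smooth(2)]
        smooth_onD(1)[OF smooth(4)] smooth_onD(1)[OF smooth(5)]
      by (simp add: lie_bracket_eq_frechet_derivative diff[symmetric])
    finally show ?thesis by simp
  qed
  then show ?thesis unfolding autotopism_def eventually_nhds using U by blast
qed


lemma transl_minus: "L (- x) g = - L x g" "R (- x) g = - R x g"
  using translation_field_scaleR[of _ "-1" x g] by (simp_all add: transl_L_def transl_R_def)

text \<open>The last condition says that \<open>mul\<close> is the identity in each argument near \<open>k\<close> when the other
  one is the unit.\<close>

definition regular :: "real ^ 'n \<Rightarrow> bool" where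
  "regular k \<longleftrightarrow> k \<in> N \<and> mul 0 k = k \<and> mul k 0 = k \<and> (\<forall>v. Dm (0, k) (0, v) = v \<and> Dm (k, 0) (v, 0) = v)"

lemma eventually_regular: "\<forall>\<^sub>F k in nhds 0. regular k"
proof -
  \<comment> \<open>The unit law holds in a neighbourhood of every \<open>k\<close> near 0, so it
    can be differentiated at \<open>k\<close> and not only at 0.\<close>
  have "\<forall>\<^sub>F k in nhds 0. \<forall>\<^sub>F g in nhds k. mul 0 g = g \<and> mul g 0 = g"
    using unit by (simp add: eventually_eventually)
  moreover have "\<forall>\<^sub>F k in nhds 0. k \<in> N" by (intro eventually_nhds_in_open open_N zero_in_N)
  ultimately show ?thesis
  proof eventually_elim
    case (elim k)
    then obtain S where S: "open S" "k \<in> S" "\<And>g. g \<in> S \<Longrightarrow> mul 0 g = g \<and> mul g 0 = g"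
      unfolding eventually_nhds by blast
    have "((\<lambda>g. mul 0 g) has_derivative (\<lambda>v. Dm (0, k) (0, v))) (at k)"
      "((\<lambda>g. mul g 0) has_derivative (\<lambda>v. Dm (k, 0) (v, 0))) (at k)"
      using elim by (auto intro!: has_derivative_mul[where f = "\<lambda>g. 0" and h = "\<lambda>g. g"]
          has_derivative_mul[where f = "\<lambda>g. g" and h = "\<lambda>g. 0"] has_derivative_ident simp: N_def)
    then have "((\<lambda>g. g) has_derivative (\<lambda>v. Dm (0, k) (0, v))) (at k)"
      "((\<lambda>g. g) has_derivative (\<lambda>v. Dm (k, 0) (v, 0))) (at k)"
      using S by (auto elim!: has_derivative_transform_within_open)
    then have "(\<lambda>v. Dm (0, k) (0, v)) = (\<lambda>v. v)" "(\<lambda>v. Dm (k, 0) (v, 0)) = (\<lambda>v. v)"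
      using has_derivative_unique has_derivative_ident by blast+
    then show ?case using elim S unfolding regular_def by (metis)
  qed
qed

lemma regular_zero: "regular 0"
  using eventually_regular by (rule eventually_nhds_x_imp_x)

text \<open>Differentiate \<open>aa\<inverse> = e\<close> at the unit, where \<open>Dm\<close> is
  addition of its two arguments.\<close>

lemma has_derivative_iv: "(iv has_derivative (\<lambda>x. - x)) (at 0)"
proof -
  note iv = frechet_derivative_has_derivative[OF iv_differentiable]
  have 1: "((\<lambda>a. mul a (iv a)) has_derivative
      (\<lambda>v. Dm (0, iv 0) (v, frechet_derivative iv (at 0) v))) (at 0)"
    using zero_in_W by (intro has_derivative_mul[where f = "\<lambda>a. a"] has_derivative_ident iv) (simp add: iv_zero)
  from inverse obtain S where S: "open S" "0 \<in> S" "\<And>g. g \<in> S \<Longrightarrow> mul g (iv g) = 0"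
    unfolding eventually_nhds by blast
  have "((\<lambda>a. mul a (iv a)) has_derivative (\<lambda>v. 0)) (at 0)"
    by (rule has_derivative_transform_within_open[OF has_derivative_const S(1,2)]) (simp add: S(3))
  from has_derivative_unique[OF 1 this] have "Dm (0, 0) (v, frechet_derivative iv (at 0) v) = 0" for v
    by (simp add: iv_zero fun_eq_iff)
  then have "frechet_derivative iv (at 0) v = - v" for v
    using Dm_Pair[OF zero_in_W] regular_zero unfolding regular_def by (metis add_eq_0_iff)
  then have "frechet_derivative iv (at 0) = (\<lambda>v. - v)" by (rule ext)
  with iv show ?thesis by simp
qed

text \<open>For \<open>a(ga)\<close> the outer \<open>a\<close> contributes \<open>L x g\<close>,
  and the inner one \<open>R x g\<close>, which regularity of \<open>g\<close> passes on unchanged;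
  their sum is \<open>- M x g\<close>. Inverting \<open>a\<close> changes the sign.\<close>

lemma has_derivative_translations:
  assumes "regular g"
  shows "((\<lambda>a. mul a g) has_derivative (\<lambda>x. L x g)) (at 0)"
    and "((\<lambda>a. mul g a) has_derivative (\<lambda>x. R x g)) (at 0)"
    and "((\<lambda>a. mul a (mul g a)) has_derivative (\<lambda>x. - M x g)) (at 0)"
    and "((\<lambda>a. mul (iv a) g) has_derivative (\<lambda>x. - L x g)) (at 0)"
    and "((\<lambda>a. mul g (iv a)) has_derivative (\<lambda>x. - R x g)) (at 0)"
proof -
  from assms have g: "g \<in> N" "(0, g) \<in> W" "(g, 0) \<in> W" "mul g 0 = g"
    "\<And>v. Dm (0, g) (0, v) = v" by (auto simp: regular_def N_def)
  show l: "((\<lambda>a. mul a g) has_derivative (\<lambda>x. L x g)) (at 0)"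
    using has_derivative_mul[of "\<lambda>a. a" 0 "\<lambda>a. g", OF _ has_derivative_ident has_derivative_const] g
    by (simp add: transl_L_eq)
  show r: "((\<lambda>a. mul g a) has_derivative (\<lambda>x. R x g)) (at 0)"
    using has_derivative_mul[of "\<lambda>a. g" 0 "\<lambda>a. a", OF _ has_derivative_const has_derivative_ident] g
    by (simp add: transl_R_eq)
  have "Dm (0, g) (x, R x g) = - M x g" for x
    using Dm_Pair[OF g(2), of x "R x g"] g by (simp add: transl_M_eq transl_L_eq)
  then show "((\<lambda>a. mul a (mul g a)) has_derivative (\<lambda>x. - M x g)) (at 0)"
    using has_derivative_mul[of "\<lambda>a. a" 0 "\<lambda>a. mul g a", OF _ has_derivative_ident r] g by simp
  show "((\<lambda>a. mul (iv a) g) has_derivative (\<lambda>x. - L x g)) (at 0)"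
    using has_derivative_compose[OF has_derivative_iv, of "\<lambda>a. mul a g" "\<lambda>x. L x g"] l by (simp add: iv_zero transl_minus)
  show "((\<lambda>a. mul g (iv a)) has_derivative (\<lambda>x. - R x g)) (at 0)"
    using has_derivative_compose[OF has_derivative_iv, of "\<lambda>a. mul g a" "\<lambda>x. R x g"] r by (simp add: iv_zero transl_minus)
qed

text \<open>The maps \<open>\<phi> a\<close>, \<open>\<psi> a\<close>, \<open>\<theta> a\<close>
  form a family of local autotopisms starting at the identity; its derivative in the parameter
  \<open>a\<close> at the unit is the infinitesimal one.\<close>

lemma autotopism_if_identity:
  assumes id: "\<forall>\<^sub>F (a, p) in nhds (0, (0, 0)). mul (\<phi> a (fst p)) (\<psi> a (snd p)) = \<theta> a (m p)"
    and \<phi>: "\<And>g. regular g \<Longrightarrow> ((\<lambda>a. \<phi> a g) has_derivative (\<lambda>x. A x g)) (at 0)" "\<And>g. regular g \<Longrightarrow> \<phi> 0 g = g"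
    and \<psi>: "\<And>g. regular g \<Longrightarrow> ((\<lambda>a. \<psi> a g) has_derivative (\<lambda>x. B x g)) (at 0)" "\<And>g. regular g \<Longrightarrow> \<psi> 0 g = g"
    and \<theta>: "\<And>g. regular g \<Longrightarrow> ((\<lambda>a. \<theta> a g) has_derivative (\<lambda>x. C x g)) (at 0)"
  shows "autotopism (A x) (B x) (C x)"
proof -
  note ev = eventually_compose_filterlim[OF eventually_regular]
  from eventually_nhds_curry[OF id] eventually_in_domains
    ev[OF tendsto_fst_snd(1)] ev[OF tendsto_fst_snd(2)] ev[OF tendsto_m]
  show ?thesis unfolding autotopism_def
  proof eventually_elim
    case (elim p)
    from elim(1) obtain S where S: "open S" "0 \<in> S"
      "\<And>a. a \<in> S \<Longrightarrow> mul (\<phi> a (fst p)) (\<psi> a (snd p)) = \<theta> a (m p)"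
      unfolding eventually_nhds by blast
    have "((\<lambda>a. mul (\<phi> a (fst p)) (\<psi> a (snd p))) has_derivative
      (\<lambda>x. Dm (\<phi> 0 (fst p), \<psi> 0 (snd p)) (A x (fst p), B x (snd p)))) (at 0)"
      using elim by (intro has_derivative_mul \<phi>(1) \<psi>(1)) (simp_all add: \<phi>(2) \<psi>(2))
    from has_derivative_transform_within_open[OF this S]
    have "((\<lambda>a. \<theta> a (m p)) has_derivative (\<lambda>x. Dm p (A x (fst p), B x (snd p)))) (at 0)"
      using elim by (simp add: \<phi>(2) \<psi>(2))
    from fun_cong[OF has_derivative_unique[OF this \<theta>]] elim show ?case by simp
  qed
qed

lemma tendsto_triple:
  "((\<lambda>q. fst q) \<longlongrightarrow> (0 :: real ^ 'n)) (nhds (0, (0 :: real ^ 'n, 0 :: real ^ 'n)))"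
  "((\<lambda>q. fst (snd q)) \<longlongrightarrow> (0 :: real ^ 'n)) (nhds (0 :: real ^ 'n, (0, 0 :: real ^ 'n)))"
  "((\<lambda>q. snd (snd q)) \<longlongrightarrow> (0 :: real ^ 'n)) (nhds (0 :: real ^ 'n, (0 :: real ^ 'n, 0)))"
proof -
  have *: "filterlim (\<lambda>q. q) (nhds (0, (0, 0))) (nhds (0 :: real ^ 'n, (0 :: real ^ 'n, 0 :: real ^ 'n)))"
    by (rule filterlim_ident)
  from tendsto_fst[OF *] tendsto_fst[OF tendsto_snd[OF *]] tendsto_snd[OF tendsto_snd[OF *]]
  show "((\<lambda>q. fst q) \<longlongrightarrow> (0 :: real ^ 'n)) (nhds (0, (0 :: real ^ 'n, 0 :: real ^ 'n)))"
  "((\<lambda>q. fst (snd q)) \<longlongrightarrow> (0 :: real ^ 'n)) (nhds (0 :: real ^ 'n, (0, 0 :: real ^ 'n)))"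
  "((\<lambda>q. snd (snd q)) \<longlongrightarrow> (0 :: real ^ 'n)) (nhds (0 :: real ^ 'n, (0 :: real ^ 'n, 0)))"
    by simp_all
qed

text \<open>These are the infinitesimal forms of \<open>(ag)(ha) = a((gh)a)\<close>, \<open>(a(ga))(a\<inverse>h) = a(gh)\<close> and
  \<open>(ga\<inverse>)(a(ha)) = (gh)a\<close>.\<close>

lemma autotopism_translations:
  "autotopism (L x) (R x) (\<lambda>g. - M x g)"
  "autotopism (\<lambda>g. - M x g) (\<lambda>g. - L x g) (L x)"
  "autotopism (\<lambda>g. - R x g) (\<lambda>g. - M x g) (R x)"
proof -
  note unit = regular_def iv_zero
  show "autotopism (L x) (R x) (\<lambda>g. - M x g)"
    by (rule autotopism_if_identity[where \<phi> = "\<lambda>a g. mul a g" and \<psi> = "\<lambda>a h. mul h a"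
          and \<theta> = "\<lambda>a k. mul a (mul k a)"])
      (use eventually_Moufang[OF tendsto_triple] in \<open>auto simp: case_prod_unfold m_def unit intro: has_derivative_translations\<close>)
  show "autotopism (\<lambda>g. - M x g) (\<lambda>g. - L x g) (L x)"
    by (rule autotopism_if_identity[where \<phi> = "\<lambda>a g. mul a (mul g a)" and \<psi> = "\<lambda>a h. mul (iv a) h"
          and \<theta> = "\<lambda>a k. mul a k"])
      (use eventually_left_Moufang[OF tendsto_triple] in \<open>auto simp: case_prod_unfold m_def unit intro: has_derivative_translations\<close>)
  show "autotopism (\<lambda>g. - R x g) (\<lambda>g. - M x g) (R x)"
    by (rule autotopism_if_identity[where \<phi> = "\<lambda>a g. mul g (iv a)" and \<psi> = "\<lambda>a h. mul a (mul h a)"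
          and \<theta> = "\<lambda>a k. mul k a"])
      (use eventually_right_Moufang[OF tendsto_triple] in \<open>auto simp: case_prod_unfold m_def unit intro: has_derivative_translations\<close>)
qed

section \<open>The Yamagutian as a derivation and its brackets with translations\<close>

abbreviation Y :: "real ^ 'n \<Rightarrow> real ^ 'n \<Rightarrow> real ^ 'n \<Rightarrow> real ^ 'n" where "Y \<equiv> Yamagutian mul"

lemma smooth_Y: "smooth_on (Y x y) N"
proof -
  have "smooth_on (\<lambda>g. (1 / 6) *\<^sub>R (lie_bracket (L x) (L y) g + lie_bracket (R x) (R y) g
      + lie_bracket (M x) (M y) g)) N"
    by (intro smooth_on_bounded_linear[OF open_N bounded_linear_scaleR_right] smooth_on_add open_N
        smooth_on_lie_bracket smooth_L smooth_R smooth_M)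
  then show ?thesis by (rule smooth_on_cong[OF open_N]) (simp add: Yamagutian_def)
qed

text \<open>Adding up the brackets of the three autotopisms makes the three components equal, so the
  Yamagutian is a derivation of the loop.\<close>

lemma autotopism_Y: "autotopism (Y x y) (Y x y) (Y x y)"
proof -
  note smooth = smooth_L smooth_R smooth_M smooth_on_minus[OF open_N smooth_L]
    smooth_on_minus[OF open_N smooth_R] smooth_on_minus[OF open_N smooth_M]
  note 1 = autotopism_lie_bracket[OF smooth(1,2,6,1,2,6) autotopism_translations(1) autotopism_translations(1), of x y]
  note 2 = autotopism_lie_bracket[OF smooth(6,4,1,6,4,1) autotopism_translations(2) autotopism_translations(2), of x y]
  note 3 = autotopism_lie_bracket[OF smooth(5,6,2,5,6,2) autotopism_translations(3) autotopism_translations(3), of x y]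
  note minus = lie_bracket_minus_minus[OF smooth_onD(1)[OF smooth_L] smooth_onD(1)[OF smooth_L]]
    lie_bracket_minus_minus[OF smooth_onD(1)[OF smooth_R] smooth_onD(1)[OF smooth_R]]
    lie_bracket_minus_minus[OF smooth_onD(1)[OF smooth_M] smooth_onD(1)[OF smooth_M]]
  from 1 2 3 eventually_in_domains show ?thesis unfolding autotopism_def
  proof eventually_elim
    case (elim p)
    interpret linear "Dm p" using linear_Dm elim by blast
    let ?l = "lie_bracket (L x) (L y)" and ?r = "lie_bracket (R x) (R y)" and ?m = "lie_bracket (M x) (M y)"
    have "Dm p (Y x y (fst p), Y x y (snd p)) = (1 / 6) *\<^sub>R
      Dm p ((?l (fst p), ?r (snd p)) + (?m (fst p), ?l (snd p)) + (?r (fst p), ?m (snd p)))"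
      unfolding scaleR[symmetric] by (simp add: Yamagutian_def algebra_simps)
    also have "\<dots> = (1 / 6) *\<^sub>R (?m (m p) + ?l (m p) + ?r (m p))"
      using elim by (simp only: add minus)
    finally show ?case by (simp add: Yamagutian_def algebra_simps)
  qed
qed

text \<open>At the unit a derivation value \<open>v\<close> satisfies
  \<open>v + v = v\<close>.\<close>

lemma Y_zero: "Y x y 0 = 0"
proof -
  from autotopism_Y[of x y] have "Dm (0, 0) (Y x y 0, Y x y 0) = Y x y 0"
    unfolding autotopism_def using eventually_nhds_x_imp_x m_zero by fastforce
  then show ?thesis using Dm_Pair[OF zero_in_W, of "Y x y 0" "Y x y 0"] regular_zero
    by (simp add: regular_def)
qed

lemma lie_bracket_Y_L:
  "\<forall>\<^sub>F h in nhds 0. lie_bracket (Y x y) (L z) h = - L (frechet_derivative (Y x y) (at 0) z) h"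
proof -
  have "\<forall>\<^sub>F (g, h) in nhds (0, 0). Dm (g, h) (Y x y g, Y x y h) = Y x y (mul g h)"
    using autotopism_Y unfolding autotopism_def by (simp add: case_prod_unfold m_def)
  from eventually_nhds_curry[OF this] eventually_regular
  show ?thesis
  proof eventually_elim
    case (elim h)
    let ?D = "frechet_derivative (Y x y)"
    from elim(1) obtain S where S: "open S" "0 \<in> S"
      "\<And>g. g \<in> S \<Longrightarrow> Dm (g, h) (Y x y g, Y x y h) = Y x y (mul g h)"
      unfolding eventually_nhds by blast
    have h: "h \<in> N" "(0, h) \<in> W" "mul 0 h = h" using elim(2) by (auto simp: regular_def N_def)
    note dY = frechet_derivative_has_derivative[OF smooth_onD(1)[OF smooth_Y[of x y]]]
    \<comment> \<open>The second component is frozen at \<open>h\<close>. Since \<open>Y\<close>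
      vanishes at the unit, the value of this field at \<open>(0, h)\<close> is
      \<open>(0, Y x y h)\<close>.\<close>
    have X: "((\<lambda>q. (Y x y (fst q), Y x y h)) has_derivative (\<lambda>w. (?D (at 0) (fst w), 0))) (at (0, h))"
      using dY[OF zero_in_N] by (intro has_derivative_Pair has_derivative_const
          has_derivative_compose[OF has_derivative_fst[OF has_derivative_ident]]) simp
    note 1 = has_derivative_frechet_derivative[OF open_W h(2) smooth_m X]
    have "((\<lambda>g. (g, h)) has_derivative (\<lambda>v. (v, 0))) (at 0)"
      by (intro has_derivative_Pair has_derivative_ident has_derivative_const)
    from has_derivative_compose[OF this 1]
    have 2: "((\<lambda>g. Dm (g, h) (Y x y g, Y x y h)) has_derivative
      (\<lambda>v. frechet_derivative (\<lambda>q. Dm q (0, Y x y h)) (at (0, h)) (v, 0) + Dm (0, h) (?D (at 0) v, 0))) (at 0)"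
      by (simp add: Y_zero)
    have 3: "((\<lambda>g. Y x y (mul g h)) has_derivative (\<lambda>v. ?D (at h) (L v h))) (at 0)"
      using has_derivative_compose[OF has_derivative_translations(1)[OF elim(2)], of "Y x y"] dY[OF h(1)] h(3) by simp
    have 4: "frechet_derivative (\<lambda>q. Dm q (0, Y x y h)) (at (0, h)) (z, 0) + Dm (0, h) (?D (at 0) z, 0)
        = ?D (at h) (L z h)"
      using fun_cong[OF has_derivative_unique[OF has_derivative_transform_within_open[OF 2 S] 3]] .
    have "((\<lambda>g. (0, g)) has_derivative (\<lambda>v. (0, v))) (at h)"
      by (intro has_derivative_Pair has_derivative_ident has_derivative_const)
    from has_derivative_compose[OF this frechet_derivative_has_derivative[OF smooth_onD(1)[OF smooth_onD(2)[OF smooth_m] h(2)]]]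
    have "((\<lambda>g. Dm (0, g) (z, 0)) has_derivative (\<lambda>v. frechet_derivative (\<lambda>q. Dm q (z, 0)) (at (0, h)) (0, v))) (at h)" .
    from has_derivative_transform_within_open[OF this open_N h(1), of "L z"]
    have "(L z has_derivative (\<lambda>v. frechet_derivative (\<lambda>q. Dm q (z, 0)) (at (0, h)) (0, v))) (at h)"
      by (simp add: transl_L_eq)
    \<comment> \<open>By symmetry the mixed second derivative of \<open>m\<close> in
      \<open>4\<close> is the derivative of \<open>L z\<close> along \<open>Y\<close>, so
      \<open>4\<close> becomes a statement about the bracket.\<close>
    then have "frechet_derivative (L z) (at h) (Y x y h) =
        frechet_derivative (\<lambda>q. Dm q (0, Y x y h)) (at (0, h)) (z, 0)"
      using real_analytic_at_second_derivative_symmetric[OF analytic_m[OF h(2)]]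
      by (simp add: frechet_derivative_eqI)
    with 4 show ?case using h(1)
      by (simp add: lie_bracket_eq_frechet_derivative smooth_onD(1)[OF smooth_Y] smooth_onD(1)[OF smooth_L]
          transl_L_eq[of h "?D (at 0) z"] algebra_simps)
  qed
qed

lemma lie_bracket_Y_R:
  "\<forall>\<^sub>F g in nhds 0. lie_bracket (Y x y) (R z) g = - R (frechet_derivative (Y x y) (at 0) z) g"
proof -
  \<comment> \<open>The pair is swapped so that currying fixes \<open>g\<close> and leaves
    \<open>h\<close> free for differentiation at the unit.\<close>
  from eventually_compose_filterlim[OF autotopism_Y[unfolded autotopism_def] tendsto_Pair[OF tendsto_fst_snd(2,1)]]
  have "\<forall>\<^sub>F (h, g) in nhds (0, 0). Dm (g, h) (Y x y g, Y x y h) = Y x y (mul g h)"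
    by (simp add: case_prod_unfold m_def)
  from eventually_nhds_curry[OF this] eventually_regular
  show ?thesis
  proof eventually_elim
    case (elim g)
    let ?D = "frechet_derivative (Y x y)"
    from elim(1) obtain S where S: "open S" "0 \<in> S"
      "\<And>h. h \<in> S \<Longrightarrow> Dm (g, h) (Y x y g, Y x y h) = Y x y (mul g h)"
      unfolding eventually_nhds by blast
    have g: "g \<in> N" "(g, 0) \<in> W" "mul g 0 = g" using elim(2) by (auto simp: regular_def N_def)
    note dY = frechet_derivative_has_derivative[OF smooth_onD(1)[OF smooth_Y[of x y]]]
    have X: "((\<lambda>q. (Y x y g, Y x y (snd q))) has_derivative (\<lambda>w. (0, ?D (at 0) (snd w)))) (at (g, 0))"
      using dY[OF zero_in_N] by (intro has_derivative_Pair has_derivative_const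
          has_derivative_compose[OF has_derivative_snd[OF has_derivative_ident]]) simp
    note 1 = has_derivative_frechet_derivative[OF open_W g(2) smooth_m X]
    have "((\<lambda>h. (g, h)) has_derivative (\<lambda>v. (0, v))) (at 0)"
      by (intro has_derivative_Pair has_derivative_ident has_derivative_const)
    from has_derivative_compose[OF this 1]
    have 2: "((\<lambda>h. Dm (g, h) (Y x y g, Y x y h)) has_derivative
      (\<lambda>v. frechet_derivative (\<lambda>q. Dm q (Y x y g, 0)) (at (g, 0)) (0, v) + Dm (g, 0) (0, ?D (at 0) v))) (at 0)"
      by (simp add: Y_zero)
    have 3: "((\<lambda>h. Y x y (mul g h)) has_derivative (\<lambda>v. ?D (at g) (R v g))) (at 0)"
      using has_derivative_compose[OF has_derivative_translations(2)[OF elim(2)], of "Y x y"] dY[OF g(1)] g(3) by simp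
    have 4: "frechet_derivative (\<lambda>q. Dm q (Y x y g, 0)) (at (g, 0)) (0, z) + Dm (g, 0) (0, ?D (at 0) z)
        = ?D (at g) (R z g)"
      using fun_cong[OF has_derivative_unique[OF has_derivative_transform_within_open[OF 2 S] 3]] .
    have "((\<lambda>h. (h, 0)) has_derivative (\<lambda>v. (v, 0))) (at g)"
      by (intro has_derivative_Pair has_derivative_ident has_derivative_const)
    from has_derivative_compose[OF this frechet_derivative_has_derivative[OF smooth_onD(1)[OF smooth_onD(2)[OF smooth_m] g(2)]]]
    have "((\<lambda>h. Dm (h, 0) (0, z)) has_derivative (\<lambda>v. frechet_derivative (\<lambda>q. Dm q (0, z)) (at (g, 0)) (v, 0))) (at g)" .
    from has_derivative_transform_within_open[OF this open_N g(1), of "R z"]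
    have "(R z has_derivative (\<lambda>v. frechet_derivative (\<lambda>q. Dm q (0, z)) (at (g, 0)) (v, 0))) (at g)"
      by (simp add: transl_R_eq)
    then have "frechet_derivative (R z) (at g) (Y x y g) =
        frechet_derivative (\<lambda>q. Dm q (Y x y g, 0)) (at (g, 0)) (0, z)"
      using real_analytic_at_second_derivative_symmetric[OF analytic_m[OF g(2)]]
      by (simp add: frechet_derivative_eqI)
    with 4 show ?case using g(1)
      by (simp add: lie_bracket_eq_frechet_derivative smooth_onD(1)[OF smooth_Y] smooth_onD(1)[OF smooth_R]
          transl_R_eq[of g "?D (at 0) z"] algebra_simps)
  qed
qed

section \<open>Yamaguti constants as derivatives of the Yamagutian at the unit\<close>

lemma Yamaguti_fun_eq: "Yamaguti_fun mul i j k g = - Y (axis j 1) (axis k 1) g $ i"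
  by (simp add: Yamaguti_fun_def Yamagutian_def secondary_eq_lie_bracket
      transl_L_def transl_R_def transl_M_def algebra_simps)

lemma Y_expansion:
  assumes "g \<in> N"
  shows "Y x y g = (\<Sum>j\<in>UNIV. \<Sum>k\<in>UNIV. (x $ j * y $ k) *\<^sub>R Y (axis j 1) (axis k 1) g)"
proof -
  note expand = lie_bracket_translation_field_expansion[of _ g x y]
  have "lie_bracket (L x) (L y) g = (\<Sum>j\<in>UNIV. \<Sum>k\<in>UNIV. (x $ j * y $ k) *\<^sub>R
      lie_bracket (L (axis j 1)) (L (axis k 1)) g)"
    using expand[of "aux_u mul"] smooth_onD(1)[OF smooth_L assms] by (simp add: transl_L_def)
  moreover have "lie_bracket (R x) (R y) g = (\<Sum>j\<in>UNIV. \<Sum>k\<in>UNIV. (x $ j * y $ k) *\<^sub>R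
      lie_bracket (R (axis j 1)) (R (axis k 1)) g)"
    using expand[of "aux_v mul"] smooth_onD(1)[OF smooth_R assms] by (simp add: transl_R_def)
  moreover have "lie_bracket (M x) (M y) g = (\<Sum>j\<in>UNIV. \<Sum>k\<in>UNIV. (x $ j * y $ k) *\<^sub>R
      lie_bracket (M (axis j 1)) (M (axis k 1)) g)"
    using expand[of "aux_w mul"] smooth_onD(1)[OF smooth_M assms] by (simp add: transl_M_def)
  ultimately show ?thesis
    by (simp add: Yamagutian_def scaleR_sum_right scaleR_add_right sum.distrib mult.commute)
qed

text \<open>The \<open>THE\<close> needs both halves: the linear approximation provides an
  expansion, and a linear form of quadratic order being zero makes it unique.\<close>

lemma Yamaguti_const_eq:
  "Yamaguti_const mul i j k $ l = - frechet_derivative (Y (axis j 1) (axis k 1)) (at 0) (axis l 1) $ i"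
proof -
  define f where "f = (\<lambda>g. - Y (axis j 1) (axis k 1) g $ i)"
  define c where "c = (\<chi> l. - frechet_derivative (Y (axis j 1) (axis k 1)) (at 0) (axis l 1) $ i)"
  note dY = smooth_onD(1)[OF smooth_Y zero_in_N]
  have f: "smooth_on f N"
    unfolding f_def by (intro smooth_on_minus smooth_on_bounded_linear[OF open_N bounded_linear_vec_nth]
        smooth_Y open_N)
  have Df: "frechet_derivative f (at 0) g = (\<Sum>l\<in>UNIV. c $ l * g $ l)" for g
  proof -
    have "frechet_derivative f (at 0) g = - frechet_derivative (Y (axis j 1) (axis k 1)) (at 0) g $ i"
      unfolding f_def by (simp add: frechet_derivative_minus frechet_derivative_vec_nth dY)
    also have "\<dots> = - (\<Sum>l\<in>UNIV. g $ l *\<^sub>R frechet_derivative (Y (axis j 1) (axis k 1)) (at 0) (axis l 1)) $ i"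
      by (subst frechet_derivative_axis_expansion[OF dY]) simp
    finally show ?thesis by (simp add: c_def sum_negf mult.commute)
  qed
  \<comment> \<open>\<open>Y_zero\<close> removes the constant term of the expansion.\<close>
  have *: "(\<lambda>g. Yamaguti_fun mul i j k g - (\<Sum>l\<in>UNIV. c $ l * g $ l)) \<in> O[nhds 0](\<lambda>g. (norm g)\<^sup>2)"
    using smooth_on_linear_approximation[OF open_N zero_in_N f, unfolded Df]
    by (simp add: Yamaguti_fun_eq f_def Y_zero)
  have "Yamaguti_const mul i j k = c"
    unfolding Yamaguti_const_def
  proof (rule the_equality)
    show "(\<lambda>g. Yamaguti_fun mul i j k g - (\<Sum>l\<in>UNIV. c $ l * g $ l)) \<in> O[nhds 0](\<lambda>g. (norm g)\<^sup>2)"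
      by (rule *)
  next
    fix d assume "(\<lambda>g. Yamaguti_fun mul i j k g - (\<Sum>l\<in>UNIV. d $ l * g $ l)) \<in> O[nhds 0](\<lambda>g. (norm g)\<^sup>2)"
    from sum_in_bigo(2)[OF * this] have "(\<lambda>g. \<Sum>l\<in>UNIV. (d - c) $ l * g $ l) \<in> O[nhds 0](\<lambda>g. (norm g)\<^sup>2)"
      by (simp add: left_diff_distrib sum_subtractf)
    from linear_form_bigo_norm_square_imp_zero[OF this] show "d = c" by simp
  qed
  then show ?thesis by (simp add: c_def)
qed

text \<open>The sign is that of \<open>Yamaguti_fun_eq\<close>. The constants are those of
  \<open>Y\<close> itself, whereas the bracket multiplies them by 6.\<close>

lemma frechet_derivative_Y:
  "frechet_derivative (Y x y) (at 0) z = - (1 / 6) *\<^sub>R Yamaguti_bracket mul x y z"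
proof (subst vec_eq_iff, rule allI)
  fix i
  let ?D = "\<lambda>j k. frechet_derivative (Y (axis j 1) (axis k 1)) (at 0)"
  note dY = smooth_onD(1)[OF smooth_Y zero_in_N]
  have "((\<lambda>g. \<Sum>j\<in>UNIV. \<Sum>k\<in>UNIV. (x $ j * y $ k) *\<^sub>R Y (axis j 1) (axis k 1) g) has_derivative
      (\<lambda>v. \<Sum>j\<in>UNIV. \<Sum>k\<in>UNIV. (x $ j * y $ k) *\<^sub>R ?D j k v)) (at 0)"
    by (intro has_derivative_sum has_derivative_scaleR_right frechet_derivative_has_derivative dY)
  from has_derivative_transform_within_open[OF this open_N zero_in_N Y_expansion[symmetric]]
  have "(Y x y has_derivative (\<lambda>v. \<Sum>j\<in>UNIV. \<Sum>k\<in>UNIV. (x $ j * y $ k) *\<^sub>R ?D j k v)) (at 0)" .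
  then have "frechet_derivative (Y x y) (at 0) z = (\<Sum>j\<in>UNIV. \<Sum>k\<in>UNIV. (x $ j * y $ k) *\<^sub>R ?D j k z)"
    by (rule frechet_derivative_eqI)
  also have "\<dots> = (\<Sum>j\<in>UNIV. \<Sum>k\<in>UNIV. (x $ j * y $ k) *\<^sub>R (\<Sum>l\<in>UNIV. z $ l *\<^sub>R ?D j k (axis l 1)))"
    by (simp only: frechet_derivative_axis_expansion[OF dY, where v = z])
  finally show "frechet_derivative (Y x y) (at 0) z $ i = (- (1 / 6) *\<^sub>R Yamaguti_bracket mul x y z) $ i"
    by (simp add: Yamaguti_bracket_def Yamaguti_const_eq sum_distrib_left sum_negf mult_ac)
qed

theorem reductivity:
  shows "\<forall>\<^sub>F g in nhds 0. 6 *\<^sub>R lie_bracket (Y x y) (L z) g = L (Yamaguti_bracket mul x y z) g"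
    and "\<forall>\<^sub>F g in nhds 0. 6 *\<^sub>R lie_bracket (Y x y) (R z) g = R (Yamaguti_bracket mul x y z) g"
    and "\<forall>\<^sub>F g in nhds 0. 6 *\<^sub>R lie_bracket (Y x y) (M z) g = M (Yamaguti_bracket mul x y z) g"
proof -
  show L: "\<forall>\<^sub>F g in nhds 0. 6 *\<^sub>R lie_bracket (Y x y) (L z) g = L (Yamaguti_bracket mul x y z) g"
    using lie_bracket_Y_L[of x y z] by eventually_elim
      (simp add: frechet_derivative_Y transl_minus, simp add: transl_L_def translation_field_scaleR)
  show R: "\<forall>\<^sub>F g in nhds 0. 6 *\<^sub>R lie_bracket (Y x y) (R z) g = R (Yamaguti_bracket mul x y z) g"
    using lie_bracket_Y_R[of x y z] by eventually_elim
      (simp add: frechet_derivative_Y transl_minus, simp add: transl_R_def translation_field_scaleR)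
  have N: "\<forall>\<^sub>F g in nhds 0. g \<in> N" by (intro eventually_nhds_in_open open_N zero_in_N)
  from L R N show "\<forall>\<^sub>F g in nhds 0. 6 *\<^sub>R lie_bracket (Y x y) (M z) g = M (Yamaguti_bracket mul x y z) g"
  proof eventually_elim
    case (elim g)
    note differentiable = smooth_onD(1)[OF smooth_L elim(3)] smooth_onD(1)[OF smooth_R elim(3)]
      smooth_onD(1)[OF smooth_M elim(3)] smooth_onD(1)[OF smooth_Y elim(3)]
    have "(M z has_derivative (\<lambda>v. - frechet_derivative (L z) (at g) v - frechet_derivative (R z) (at g) v)) (at g)"
      unfolding transl_M_eq[abs_def]
      by (intro has_derivative_diff has_derivative_minus frechet_derivative_has_derivative differentiable)
    note DM = frechet_derivative_eqI[OF this]
    interpret linear "frechet_derivative (Y x y) (at g)" using linear_frechet_derivative[OF differentiable(4)] .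
    \<comment> \<open>The bracket with \<open>Y\<close> is linear in the second field, so the case
      of \<open>M\<close> is minus the sum of the other two.\<close>
    have "lie_bracket (Y x y) (M z) g = - lie_bracket (Y x y) (L z) g - lie_bracket (Y x y) (R z) g"
      unfolding lie_bracket_eq_frechet_derivative[OF differentiable(4,1)] lie_bracket_eq_frechet_derivative[OF differentiable(4,2)]
        lie_bracket_eq_frechet_derivative[OF differentiable(4,3)] DM transl_M_eq by (simp add: diff neg)
    then show ?case using elim(1,2) by (simp add: transl_M_eq scaleR_diff_right)
  qed
qed

end

theorem theorem4p3:
  fixes mul :: "real ^ 'n \<Rightarrow> real ^ 'n \<Rightarrow> real ^ 'n"
    and iv :: "real ^ 'n \<Rightarrow> real ^ 'n"
    and x y z :: "real ^ 'n"
  assumes "local_analytic_Moufang_loop mul iv"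
  shows "(\<forall>\<^sub>F g in nhds 0. 6 *\<^sub>R lie_bracket (Yamagutian mul x y) (transl_L mul z) g
            = transl_L mul (Yamaguti_bracket mul x y z) g) \<and>
         (\<forall>\<^sub>F g in nhds 0. 6 *\<^sub>R lie_bracket (Yamagutian mul x y) (transl_R mul z) g
            = transl_R mul (Yamaguti_bracket mul x y z) g) \<and>
         (\<forall>\<^sub>F g in nhds 0. 6 *\<^sub>R lie_bracket (Yamagutian mul x y) (transl_M mul z) g
            = transl_M mul (Yamaguti_bracket mul x y z) g)"
proof -
  interpret local_analytic_Moufang_loop mul iv by fact
  show ?thesis using reductivity by blast
qed

end
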